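(* Let $n\ge 4$ and let $I$ be an order ideal of the poset $(\mathcal{F}_4(n),\preceq)$ with $n\ge\max\bigcup I$ (in particular $I\neq\emptyset$). Then the squeezed $3$-sphere $S(I)$ can be realized as the boundary complex of a simplicial convex $4$-polytope, i.e. there is a simplicial convex $4$-polytope whose boundary complex is combinatorially isomorphic to $S(I)$.
   Context: For $A=\{a_1<\dots<a_m\}$ and $B=\{b_1<\dots<b_m\}$ finite sets of integers of the same size, write $A\preceq B$ if $a_k\le b_k$ for all $k=1,\dots,m$; this is a partial order on $m$-element subsets. For $n\in\mathbb{N}$, let $\mathcal{F}_3(n)$ be the set of $4$-element subsets of $[n]=\{1,\dots,n\}$ of the form $\{i,i+1,j,j+1\}$ with $i\ge 1$, $j\ge i+2$ and $j+1\le n$, partially ordered by $\preceq$. Let $\mathcal{F}_4(n)=\{\{0\}\cup f': f'\in\mathcal{F}_3(n)\}$ with the induced partial order $\preceq$. An order ideal $I$ of $\mathcal{F}_4(n)$ is a subset closed downwards under $\preceq$ (if $f\in I$ and $e\preceq f$, $e\in\mathcal{F}_4(n)$, then $e\in I$). The squeezed $4$-ball $B(I)$ is the pure $4$-dimensional simplicial complex on vertex set $\{0,1,\dots,n\}$ whose facets are the $5$-sets in $I$ (together with all their subsets); its underlying space is a $4$-ball, and the squeezed $3$-sphere $S(I)$ is the boundary complex of $B(I)$. *)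

theory Defs
  imports "HOL-Analysis.Analysis"
begin

section \<open>The poset of facets\<close>

text \<open>
  Componentwise comparison of the increasing enumerations; \<^const>\<open>list_all2\<close> also
  forces the two sets to have the same size.
\<close>

definition set_preceq :: "'a::linorder set \<Rightarrow> 'a set \<Rightarrow> bool" (infix \<open>\<preceq>\<close> 50) where
  "A \<preceq> B \<longleftrightarrow> finite A \<and> finite B \<and>
     list_all2 (\<le>) (sorted_list_of_set A) (sorted_list_of_set B)"

definition F3 :: "nat \<Rightarrow> nat set set" where
  "F3 n = {{i, i + 1, j, j + 1} | i j. 1 \<le> i \<and> i + 2 \<le> j \<and> j + 1 \<le> n}"

definition F4 :: "nat \<Rightarrow> nat set set" where
  "F4 n = {{0} \<union> f | f. f \<in> F3 n}"

definition order_ideal_F4 :: "nat \<Rightarrow> nat set set \<Rightarrow> bool" where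
  "order_ideal_F4 n I \<longleftrightarrow>
     I \<subseteq> F4 n \<and> (\<forall>f\<in>I. \<forall>e\<in>F4 n. e \<preceq> f \<longrightarrow> e \<in> I)"

section \<open>Squeezed balls and spheres\<close>

text \<open>Abstract simplicial complexes are sets of faces; the empty face is included.\<close>

definition complex_of_facets :: "'a set set \<Rightarrow> 'a set set" where
  "complex_of_facets \<F> = {s. \<exists>f\<in>\<F>. s \<subseteq> f}"

text \<open>
  The boundary of a pure \<open>d\<close>-dimensional complex is generated by the
  \<open>(d - 1)\<close>-faces (\<open>d\<close> vertices) lying in exactly one \<open>d\<close>-face (\<open>d + 1\<close> vertices).
  For a triangulated ball this is the subcomplex triangulating the boundary sphere.
\<close>

definition boundary_complex :: "nat \<Rightarrow> 'a set set \<Rightarrow> 'a set set" where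
  "boundary_complex d K = complex_of_facets
     {r \<in> K. card r = d \<and> (\<exists>!f. f \<in> K \<and> card f = d + 1 \<and> r \<subseteq> f)}"

definition squeezed_ball :: "nat set set \<Rightarrow> nat set set" where
  "squeezed_ball I = complex_of_facets I"

definition squeezed_sphere :: "nat set set \<Rightarrow> nat set set" where
  "squeezed_sphere I = boundary_complex 4 (squeezed_ball I)"

section \<open>Simplicial polytopes\<close>

definition simplicial_polytope :: "'a::euclidean_space set \<Rightarrow> bool" where
  "simplicial_polytope P \<longleftrightarrow> polytope P \<and> (\<forall>F. F facet_of P \<longrightarrow> (\<exists>k. k simplex F))"

text \<open>All proper faces, the empty face included.\<close>

definition polytope_boundary :: "'a::euclidean_space set \<Rightarrow> 'a set set" where
  "polytope_boundary P = {F. F face_of P \<and> F \<noteq> P}"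

text \<open>
  Isomorphism of face posets. It applies both to abstract complexes (faces are vertex
  sets) and to complexes of convex polytopes (faces are point sets).
\<close>

definition combinatorially_isomorphic :: "'a set set \<Rightarrow> 'b set set \<Rightarrow> bool" where
  "combinatorially_isomorphic K L \<longleftrightarrow>
     (\<exists>\<phi>. bij_betw \<phi> K L \<and> (\<forall>s\<in>K. \<forall>t\<in>K. s \<subseteq> t \<longleftrightarrow> \<phi> s \<subseteq> \<phi> t))"

end

theory Submission
  imports Defs
begin

text \<open>
  Put the vertices \<open>1, \<dots>, m\<close> on a moment curve and the apex \<open>0\<close> at infinity in the direction of the
  third moment. A hyperplane is then a polynomial \<open>p\<close> of degree at most 4: its value at vertex
  \<open>k\<close> is \<open>p (t k)\<close> and its value at the apex is the coefficient of \<open>s ^ 3\<close>. For the facet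
  \<open>i, i + 1, j, j + 1\<close> of the cyclic polytope the latter is minus the sum of the four
  parameters, so the apex sees the facet iff that sum is positive. An order ideal of pairs
  \<open>(i, j)\<close> is a shifted, hence threshold, family; for suitable \<open>t\<close> growing exponentially away from 0
  the sum is negative exactly on the ideal. So the apex sees precisely the
  facets outside the ideal, and the polytope has the boundary of the squeezed ball as its boundary.
  A projective map with homogenizing coordinate \<open>M + s ^ 3\<close>, positive at all vertices for large \<open>M\<close>,
  moves the apex to the origin.
\<close>

section \<open>Simplicial polytopes from certified facets\<close>

text \<open>A hyperplane containing all the other points contains their affine hull, so it keeps
  \<open>x k\<close> out of that hull. The same hyperplane rules out \<open>x k = x l\<close> for
  another index \<open>l\<close>.\<close>

lemma not_affine_dependent_imageI:
  fixes x :: "'i \<Rightarrow> 'a::euclidean_space"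
  assumes "\<And>k. k \<in> S \<Longrightarrow> \<exists>a b. (\<forall>l\<in>S - {k}. a \<bullet> x l = b) \<and> a \<bullet> x k \<noteq> b"
  shows "inj_on x S" "\<not> affine_dependent (x ` S)"
proof -
  show inj: "inj_on x S"
  proof (rule inj_onI, rule ccontr)
    fix k l assume "k \<in> S" "l \<in> S" "x k = x l" "k \<noteq> l"
    with assms[of k] show False by force
  qed
  show "\<not> affine_dependent (x ` S)"
  proof
    assume "affine_dependent (x ` S)"
    then obtain k where k: "k \<in> S" "x k \<in> affine hull (x ` S - {x k})"
      unfolding affine_dependent_def by auto
    obtain a b where ab: "\<forall>l\<in>S - {k}. a \<bullet> x l = b" "a \<bullet> x k \<noteq> b"
      using assms[OF k(1)] by blast
    have "affine hull (x ` S - {x k}) \<subseteq> {y. a \<bullet> y = b}"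
      using ab(1) by (intro hull_minimal affine_hyperplane) auto
    with k(2) ab(2) show False by auto
  qed
qed

text \<open>A finite certificate for a face lattice. \<open>supp\<close> makes each listed set an
  exposed face and \<open>indep\<close> makes it a simplex. \<open>compl\<close> excludes further
  facets, since the hyperplane of a facet of a full-dimensional hull carries at least
  \<open>DIM('a)\<close> of the indexed points. Every nonempty proper face lies in a facet and is
  thus spanned by a subset of a listed set.\<close>

lemma convex_hull_simplicial_from_facets:
  fixes x :: "'i \<Rightarrow> 'a::euclidean_space" and V :: "'i set"
  assumes fin: "finite V" and cardV: "card V > DIM('a)" and ne: "\<Delta> \<noteq> {}"
    and facet: "\<And>\<sigma>. \<sigma> \<in> \<Delta> \<Longrightarrow> \<sigma> \<subseteq> V \<and> card \<sigma> = DIM('a)"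
    and supp: "\<And>\<sigma>. \<sigma> \<in> \<Delta> \<Longrightarrow> \<exists>a b. (\<forall>k\<in>\<sigma>. a \<bullet> x k = b) \<and> (\<forall>k\<in>V - \<sigma>. a \<bullet> x k < b)"
    and indep: "\<And>\<sigma> k. \<lbrakk>\<sigma> \<in> \<Delta>; k \<in> \<sigma>\<rbrakk> \<Longrightarrow> \<exists>a b. (\<forall>l\<in>\<sigma> - {k}. a \<bullet> x l = b) \<and> a \<bullet> x k \<noteq> b"
    and compl: "\<And>a b. \<lbrakk>a \<noteq> 0; \<forall>k\<in>V. a \<bullet> x k \<le> b; DIM('a) \<le> card {k\<in>V. a \<bullet> x k = b}\<rbrakk>
                  \<Longrightarrow> \<exists>\<sigma>\<in>\<Delta>. {k\<in>V. a \<bullet> x k = b} \<subseteq> \<sigma>"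
  defines "P \<equiv> convex hull (x ` V)"
  shows "simplicial_polytope P" "aff_dim P = DIM('a)"
    "combinatorially_isomorphic (complex_of_facets \<Delta>) (polytope_boundary P)"
proof -
  have poly: "polytope P" unfolding P_def polytope_def using fin by blast
  have comp: "compact (x ` V)" using fin by (simp add: finite_imp_compact)
  have inP: "x k \<in> P" if "k \<in> V" for k
    unfolding P_def using that by (simp add: hull_inc)
  have aff: "\<not> affine_dependent (x ` \<sigma>)" and inj: "inj_on x \<sigma>" if "\<sigma> \<in> \<Delta>" for \<sigma>
    using not_affine_dependent_imageI[of \<sigma> x] indep[OF that] by blast+
  have P_le: "P \<subseteq> {y. a \<bullet> y \<le> b}" if "\<forall>k\<in>V. a \<bullet> x k \<le> b" for a b
    unfolding P_def using that by (intro hull_minimal convex_halfspace_le) auto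
  \<comment> \<open>A face of a hull is spanned by the generators it contains. Taking all of them
    makes the index set recoverable from the face.\<close>
  have face_sub: "\<exists>s\<subseteq>V. F = convex hull (x ` s) \<and> s = {k\<in>V. x k \<in> F}" if F: "F face_of P" for F
  proof -
    obtain S' where S': "S' \<subseteq> x ` V" "F = convex hull S'"
      using face_of_convex_hull_subset[OF comp] F unfolding P_def by metis
    let ?s = "{k\<in>V. x k \<in> F}"
    have "S' \<subseteq> x ` ?s" using S' by (auto intro: hull_inc)
    hence "F \<subseteq> convex hull (x ` ?s)" using S'(2) hull_mono by metis
    moreover have "convex hull (x ` ?s) \<subseteq> F"
      using face_of_imp_convex[OF F] by (intro hull_minimal) auto
    ultimately show ?thesis by (intro exI[of _ ?s]) (simp add: subset_antisym)
  qed
  have facet_face: "convex hull (x ` \<sigma>) = P \<inter> {y. a \<bullet> y = b}"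
    if \<sigma>: "\<sigma> \<in> \<Delta>" and ab: "\<forall>k\<in>\<sigma>. a \<bullet> x k = b" "\<forall>k\<in>V - \<sigma>. a \<bullet> x k < b" for \<sigma> a b
  proof
    show "convex hull (x ` \<sigma>) \<subseteq> P \<inter> {y. a \<bullet> y = b}"
      using facet[OF \<sigma>] ab(1) unfolding P_def
      by (intro Int_greatest hull_mono hull_minimal convex_hyperplane) auto
    have "\<forall>k\<in>V. a \<bullet> x k \<le> b" using ab by (metis DiffI less_eq_real_def)
    from P_le[OF this] have "(P \<inter> {y. a \<bullet> y = b}) face_of P"
      by (intro face_of_Int_supporting_hyperplane_le) (auto simp: P_def)
    then obtain s where s: "P \<inter> {y. a \<bullet> y = b} = convex hull (x ` s)"
        "s = {k\<in>V. x k \<in> P \<inter> {y. a \<bullet> y = b}}"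
      using face_sub by blast
    have "s \<subseteq> \<sigma>" using ab(2) unfolding s(2) by force
    with s(1) show "P \<inter> {y. a \<bullet> y = b} \<subseteq> convex hull (x ` \<sigma>)"
      using hull_mono image_mono by metis
  qed
  have facet_face': "convex hull (x ` \<sigma>) face_of P" and mem: "k \<in> V \<Longrightarrow> x k \<in> convex hull (x ` \<sigma>) \<Longrightarrow> k \<in> \<sigma>"
    if \<sigma>: "\<sigma> \<in> \<Delta>" for \<sigma> k
  proof -
    obtain a b where ab: "\<forall>k\<in>\<sigma>. a \<bullet> x k = b" "\<forall>k\<in>V - \<sigma>. a \<bullet> x k < b"
      using supp[OF \<sigma>] by blast
    have "\<forall>k\<in>V. a \<bullet> x k \<le> b" using ab by (metis DiffI less_eq_real_def)
    from P_le[OF this] show "convex hull (x ` \<sigma>) face_of P"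
      unfolding facet_face[OF \<sigma> ab]
      by (intro face_of_Int_supporting_hyperplane_le) (auto simp: P_def)
    show "k \<in> \<sigma>" if "k \<in> V" "x k \<in> convex hull (x ` \<sigma>)"
      using that ab(2) unfolding facet_face[OF \<sigma> ab] by force
  qed
  \<comment> \<open>This vertex off the simplex is what makes its faces proper.\<close>
  have outside: "\<exists>k\<in>V. k \<notin> \<sigma>" if \<sigma>: "\<sigma> \<in> \<Delta>" for \<sigma>
    using facet[OF \<sigma>] cardV by (metis less_irrefl subsetI subset_antisym)
  have sub_face: "convex hull (x ` s) \<in> polytope_boundary P" if s: "s \<subseteq> \<sigma>" and \<sigma>: "\<sigma> \<in> \<Delta>" for s \<sigma>
  proof -
    have "convex hull (x ` s) face_of convex hull (x ` \<sigma>)"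
      using face_of_convex_hull_affine_independent[OF aff[OF \<sigma>]] s by blast
    hence f: "convex hull (x ` s) face_of P" using facet_face'[OF \<sigma>] face_of_trans by blast
    obtain k where k: "k \<in> V" "k \<notin> \<sigma>" using outside[OF \<sigma>] by blast
    hence "x k \<notin> convex hull (x ` \<sigma>)" using mem[OF \<sigma>] by blast
    hence "x k \<notin> convex hull (x ` s)" using hull_mono[OF image_mono[OF s, of x], of convex] by blast
    with inP[OF k(1)] f show ?thesis unfolding polytope_boundary_def by auto
  qed
  have order: "s \<subseteq> t \<longleftrightarrow> convex hull (x ` s) \<subseteq> convex hull (x ` t)"
    if st: "s \<in> complex_of_facets \<Delta>" "t \<in> complex_of_facets \<Delta>" for s t
  proof
    show "convex hull (x ` s) \<subseteq> convex hull (x ` t)" if "s \<subseteq> t"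
      using that by (intro hull_mono image_mono)
    assume sub: "convex hull (x ` s) \<subseteq> convex hull (x ` t)"
    obtain \<sigma> \<tau> where \<sigma>: "\<sigma> \<in> \<Delta>" "s \<subseteq> \<sigma>" and \<tau>: "\<tau> \<in> \<Delta>" "t \<subseteq> \<tau>"
      using st unfolding complex_of_facets_def by auto
    show "s \<subseteq> t"
    proof
      fix k assume k: "k \<in> s"
      hence kV: "k \<in> V" using \<sigma> facet by blast
      have kt: "x k \<in> convex hull (x ` t)" using sub k by (meson hull_inc imageI subsetD)
      hence "x k \<in> convex hull (x ` \<tau>)" using hull_mono[OF image_mono[OF \<tau>(2), of x], of convex] by blast
      hence k\<tau>: "k \<in> \<tau>" using mem[OF \<tau>(1) kV] by blast
      show "k \<in> t"
      proof (rule ccontr)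
        assume "k \<notin> t"
        \<comment> \<open>Independence inside \<open>\<tau>\<close> yields a hyperplane through all
          its vertices except \<open>k\<close>, hence through the hull of \<open>t\<close>.\<close>
        obtain a b where "\<forall>l\<in>\<tau> - {k}. a \<bullet> x l = b" and n: "a \<bullet> x k \<noteq> b"
          using indep[OF \<tau>(1) k\<tau>] by blast
        hence "x ` t \<subseteq> {y. a \<bullet> y = b}" using \<tau>(2) \<open>k \<notin> t\<close> by blast
        hence "convex hull (x ` t) \<subseteq> {y. a \<bullet> y = b}"
          by (intro hull_minimal convex_hyperplane)
        with kt n show False by blast
      qed
    qed
  qed
  have F_simplex: "\<exists>\<sigma>\<in>\<Delta>. {k\<in>V. x k \<in> F} \<subseteq> \<sigma> \<and> F = convex hull (x ` {k\<in>V. x k \<in> F})"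
    if F: "F facet_of P" and dim: "aff_dim P = DIM('a)" for F
  proof -
    obtain a b where ab: "a \<noteq> 0" "P \<subseteq> {y. a \<bullet> y \<le> b}" "F = P \<inter> {y. a \<bullet> y = b}"
      using facet_of_polyhedron[OF polytope_imp_polyhedron[OF poly] F] by metis
    have F': "F = convex hull (x ` {k\<in>V. x k \<in> F})"
      using face_sub[of F] F by (auto simp: facet_of_def)
    have Z: "{k\<in>V. x k \<in> F} = {k\<in>V. a \<bullet> x k = b}" using ab(3) inP by auto
    \<comment> \<open>A set of affine dimension \<open>DIM('a) - 1\<close> needs at least
      \<open>DIM('a)\<close> spanning points, which is the count that \<open>compl\<close> asks
      for.\<close>
    have "int DIM('a) - 1 = aff_dim F" using F dim by (simp add: facet_of_def)
    also have "\<dots> = aff_dim (x ` {k\<in>V. x k \<in> F})" using aff_dim_convex_hull[of "x ` {k\<in>V. x k \<in> F}"] F' by metis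
    also have "\<dots> \<le> int (card (x ` {k\<in>V. x k \<in> F})) - 1"
      using fin by (intro aff_dim_le_card) auto
    also have "\<dots> \<le> int (card {k\<in>V. x k \<in> F}) - 1"
      using card_image_le[of "{k\<in>V. x k \<in> F}" x] fin by simp
    finally have "DIM('a) \<le> card {k\<in>V. a \<bullet> x k = b}" unfolding Z by simp
    then obtain \<sigma> where "\<sigma> \<in> \<Delta>" "{k\<in>V. a \<bullet> x k = b} \<subseteq> \<sigma>"
      using compl[OF ab(1), of b] ab(2) inP by blast
    with F' Z show ?thesis by metis
  qed
  show dim: "aff_dim P = DIM('a)"
  proof -
    \<comment> \<open>A listed simplex has dimension \<open>DIM('a) - 1\<close> and is a proper
      face, so the hull can only be full-dimensional.\<close>
    obtain \<sigma> where \<sigma>: "\<sigma> \<in> \<Delta>" using ne by blast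
    have f: "convex hull (x ` \<sigma>) face_of P" "convex hull (x ` \<sigma>) \<noteq> P"
      using sub_face[OF _ \<sigma>] by (auto simp: polytope_boundary_def)
    have "aff_dim (convex hull (x ` \<sigma>)) < aff_dim P"
      using face_of_aff_dim_lt[OF polytope_imp_convex[OF poly] f] .
    moreover have "aff_dim (convex hull (x ` \<sigma>)) = int DIM('a) - 1"
      using aff[OF \<sigma>] facet[OF \<sigma>] card_image[OF inj[OF \<sigma>]]
      unfolding aff_dim_convex_hull by (simp add: affine_independent_iff_card)
    ultimately show ?thesis using aff_dim_le_DIM[of P] by linarith
  qed
  show "simplicial_polytope P"
    unfolding simplicial_polytope_def
  proof (intro conjI allI impI poly)
    fix F assume "F facet_of P"
    from F_simplex[OF this dim] obtain \<sigma> where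
      \<sigma>: "\<sigma> \<in> \<Delta>" "{k\<in>V. x k \<in> F} \<subseteq> \<sigma>" "F = convex hull (x ` {k\<in>V. x k \<in> F})" by blast
    have "\<not> affine_dependent (x ` {k\<in>V. x k \<in> F})"
      using aff[OF \<sigma>(1)] \<sigma>(2) affine_dependent_subset image_mono by metis
    thus "\<exists>k. k simplex F"
      using \<sigma>(3) unfolding simplex_def by (metis diff_add_cancel)
  qed
  have "bij_betw (\<lambda>s. convex hull (x ` s)) (complex_of_facets \<Delta>) (polytope_boundary P)"
    unfolding bij_betw_def
  proof (intro conjI subset_antisym subsetI)
    show "inj_on (\<lambda>s. convex hull (x ` s)) (complex_of_facets \<Delta>)"
      by (rule inj_onI) (metis order subset_antisym order_refl)
    fix F
    show "F \<in> polytope_boundary P" if "F \<in> (\<lambda>s. convex hull (x ` s)) ` complex_of_facets \<Delta>"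
      using that sub_face by (auto simp: complex_of_facets_def)
    assume "F \<in> polytope_boundary P"
    hence F: "F face_of P" "F \<noteq> P" by (auto simp: polytope_boundary_def)
    obtain s where s: "s \<subseteq> V" "F = convex hull (x ` s)" "s = {k\<in>V. x k \<in> F}"
      using face_sub[OF F(1)] by blast
    have "\<exists>\<sigma>\<in>\<Delta>. s \<subseteq> \<sigma>"
    proof (cases "F = {}")
      case True
      thus ?thesis using s(3) ne by auto
    next
      case False
      then obtain F' where F': "F' facet_of P" "F \<subseteq> F'"
        using face_of_polyhedron_subset_facet[OF polytope_imp_polyhedron[OF poly] F(1)] F(2) by metis
      show ?thesis using F_simplex[OF F'(1) dim] F'(2) s(3) by blast
    qed
    thus "F \<in> (\<lambda>s. convex hull (x ` s)) ` complex_of_facets \<Delta>"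
      using s(2) by (auto simp: complex_of_facets_def)
  qed
  with order show "combinatorially_isomorphic (complex_of_facets \<Delta>) (polytope_boundary P)"
    unfolding combinatorially_isomorphic_def by blast
qed

section \<open>Threshold points\<close>

text \<open>An increasing map with exponential growth in both directions. It is an odd function
  except at 0, where its value is 1.\<close>

definition signed_pow :: "int \<Rightarrow> real" where
  "signed_pow u = (if u < 0 then - (2 ^ nat (- u)) else 2 ^ nat u)"

lemma signed_pow_minus: "u \<noteq> 0 \<Longrightarrow> signed_pow (- u) = - signed_pow u"
  by (auto simp: signed_pow_def)

lemma signed_pow_strict_mono: "u < v \<Longrightarrow> signed_pow u < signed_pow v"
proof -
  assume "u < v"
  moreover have "- (2 ^ i) < (2::real) ^ j" for i j
    by (smt (verit) zero_less_power)
  ultimately show ?thesis by (auto simp: signed_pow_def)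
qed

lemma signed_pow_mono: "u \<le> v \<Longrightarrow> signed_pow u \<le> signed_pow v"
  using signed_pow_strict_mono by (cases "u = v") (auto intro: less_imp_le)

text \<open>As \<open>u + v\<close> is even, \<open>u + v < 0\<close> improves to
  \<open>v \<le> - u - 2\<close>. Each of the other three terms is then at most a quarter of
  \<open>2 ^ nat (- u)\<close>, so together they cannot offset the term of \<open>u\<close>.\<close>

lemma signed_pow_sum_neg:
  assumes "u + v < 0" "odd u" "odd v" "u \<le> v" "p \<le> v" "q \<le> v"
  shows "signed_pow u + signed_pow p + signed_pow q + signed_pow v < 0"
proof -
  have u: "u < 0" using assms by linarith
  have "even (u + v)" using assms by simp
  hence v: "v \<le> - u - 2" using assms(1) by presburger
  have "signed_pow y \<le> 2 ^ nat (- u) / 4" if "y \<le> v" for y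
  \<comment> \<open>For \<open>u = -1\<close> the exponent \<open>- u - 2\<close> used below would
    be negative, but then the term itself is negative.\<close>
  proof (cases "u = -1")
    case True
    with v that have "y < 0" by simp
    then show ?thesis unfolding signed_pow_def by (smt (verit) zero_le_power divide_nonneg_nonneg)
  next
    case False
    have "signed_pow y \<le> signed_pow (- u - 2)" using that v by (intro signed_pow_mono) auto
    also have "\<dots> = 2 ^ (nat (- u) - 2)" using u False by (simp add: signed_pow_def nat_diff_distrib')
    also have "\<dots> = 2 ^ nat (- u) / 4" using u False by (subst power_diff) auto
    finally show ?thesis .
  qed
  from this[of p] this[of q] this[of v] assms have
    "signed_pow u + signed_pow p + signed_pow q + signed_pow v \<le> signed_pow u + 3 * (2 ^ nat (- u) / 4)"
    by simp
  also have "\<dots> < 0" using u by (simp add: signed_pow_def)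
  finally show ?thesis .
qed

text \<open>Reflection of the negative case; odd levels are nonzero, so negation passes through
  \<open>signed_pow\<close>.\<close>

lemma signed_pow_sum_pos:
  assumes "u + v > 0" "odd u" "odd v" "u \<le> v" "u \<le> p" "u \<le> q" "odd p" "odd q"
  shows "signed_pow u + signed_pow p + signed_pow q + signed_pow v > 0"
proof -
  have "signed_pow (- v) + signed_pow (- p) + signed_pow (- q) + signed_pow (- u) < 0"
    using assms by (intro signed_pow_sum_neg) auto
  moreover have "u \<noteq> 0" "v \<noteq> 0" "p \<noteq> 0" "q \<noteq> 0" using assms by auto
  ultimately show ?thesis by (simp add: signed_pow_minus)
qed

text \<open>
  If \<open>G a b\<close> then \<open>b\<close> is at most the length of row \<open>a\<close> and vice versa, otherwise both inequalities
  are strictly reversed. Adding the two shows that index minus row length is a threshold weight for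
  \<open>G\<close>; doubling and subtracting 1 keeps the sums away from 0.
\<close>

definition threshold_level :: "nat \<Rightarrow> (nat \<Rightarrow> nat \<Rightarrow> bool) \<Rightarrow> nat \<Rightarrow> int" where
  "threshold_level m G i = 2 * (int i - int (card {j\<in>{1..m}. G i j})) - 1"

definition threshold_point :: "nat \<Rightarrow> (nat \<Rightarrow> nat \<Rightarrow> bool) \<Rightarrow> nat \<Rightarrow> real" where
  "threshold_point m G i = signed_pow (threshold_level m G i)"

text \<open>Rows of \<open>G\<close> are initial segments by downward closure, so
  \<open>G i j\<close> amounts to comparing \<open>j\<close> with the row length. The levels
  increase with the index and are odd, so the smallest and the largest index alone decide the sign
  of the sum.\<close>

lemma threshold_point:
  fixes G :: "nat \<Rightarrow> nat \<Rightarrow> bool"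
  assumes sym: "\<And>a b. G a b \<Longrightarrow> G b a"
    and down: "\<And>a b a' b'. G a b \<Longrightarrow> a' \<le> a \<Longrightarrow> b' \<le> b \<Longrightarrow> G a' b'"
  shows "\<lbrakk>1 \<le> a; a < b; b \<le> m\<rbrakk> \<Longrightarrow> threshold_point m G a < threshold_point m G b"
    and "\<lbrakk>1 \<le> a; a \<le> b; b \<le> c; c \<le> d; d \<le> m; G a d\<rbrakk> \<Longrightarrow>
      threshold_point m G a + threshold_point m G b + threshold_point m G c + threshold_point m G d < 0"
    and "\<lbrakk>1 \<le> a; a \<le> b; b \<le> c; c \<le> d; d \<le> m; \<not> G a d\<rbrakk> \<Longrightarrow>
      threshold_point m G a + threshold_point m G b + threshold_point m G c + threshold_point m G d > 0"
proof -
  define r where "r i = card {j\<in>{1..m}. G i j}" for i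
  define u where "u i = threshold_level m G i" for i
  have u: "u i = 2 * (int i - int (r i)) - 1" for i
    by (simp add: u_def r_def threshold_level_def)
  have row: "j \<le> r i" if "G i j" "j \<le> m" for i j
  proof -
    have "{1..j} \<subseteq> {j\<in>{1..m}. G i j}" using that down by fastforce
    from card_mono[OF _ this] show ?thesis by (simp add: r_def)
  qed
  have row': "r i < j" if "\<not> G i j" "1 \<le> j" for i j
  proof -
    have "{j\<in>{1..m}. G i j} \<subseteq> {1..<j}" using that down by (fastforce simp: not_less[symmetric])
    from card_mono[OF _ this] show ?thesis using that by (simp add: r_def)
  qed
  have r_anti: "r b \<le> r a" if "a \<le> b" for a b
    unfolding r_def using that down by (intro card_mono) auto
  have u_mono: "u a < u b" if "a < b" for a b
    using r_anti[of a b] that by (simp add: u)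
  have u_le: "u a \<le> u b" if "a \<le> b" for a b
    using u_mono[of a b] that by (cases "a = b") auto
  have odd: "odd (u a)" for a by (simp add: u)
  have neg: "u a + u d < 0" if "a \<le> m" "d \<le> m" "G a d" for a d
    using row[of a d] row[of d a] sym[of a d] that by (simp add: u)
  have pos: "u a + u d > 0" if "1 \<le> a" "1 \<le> d" "\<not> G a d" for a d
  proof -
    have "r a < d" "r d < a" using row' sym that by blast+
    thus ?thesis by (simp add: u)
  qed
  show "threshold_point m G a < threshold_point m G b" if "a < b"
    using signed_pow_strict_mono[OF u_mono[OF that]] by (simp add: threshold_point_def u_def)
  show "threshold_point m G a + threshold_point m G b + threshold_point m G c + threshold_point m G d < 0"
    if "1 \<le> a" "a \<le> b" "b \<le> c" "c \<le> d" "d \<le> m" "G a d"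
    unfolding threshold_point_def u_def[symmetric]
    using that odd by (intro signed_pow_sum_neg neg u_le) auto
  show "threshold_point m G a + threshold_point m G b + threshold_point m G c + threshold_point m G d > 0"
    if "1 \<le> a" "a \<le> b" "b \<le> c" "c \<le> d" "d \<le> m" "\<not> G a d"
    unfolding threshold_point_def u_def[symmetric]
    using that odd by (intro signed_pow_sum_pos pos u_le) auto
qed

section \<open>Points on the curve and their hyperplanes\<close>

definition vec4 :: "real \<Rightarrow> real \<Rightarrow> real \<Rightarrow> real \<Rightarrow> real ^ 4" where
  "vec4 p q r s = (\<chi> i. if i = 1 then p else if i = 2 then q else if i = 3 then r else s)"

lemma vec4_nth: "vec4 p q r s $ 1 = p" "vec4 p q r s $ 2 = q" "vec4 p q r s $ 3 = r" "vec4 p q r s $ 4 = s"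
  by (simp_all add: vec4_def)

lemma inner_vec4: "a \<bullet> vec4 p q r s = a $ 1 * p + a $ 2 * q + a $ 3 * r + a $ 4 * s"
  by (simp add: inner_vec_def sum_4 vec4_nth)

section \<open>Small sets in increasing order and polynomials with prescribed roots\<close>

lemma card_3_nat_sorted:
  fixes S :: "nat set"
  assumes "card S = 3"
  obtains a b d where "a < b" "b < d" "S = {a, b, d}"
proof -
  have fin: "finite S" using assms by (intro card_ge_0_finite) simp
  have "length (sorted_list_of_set S) = Suc (Suc (Suc 0))" using assms by simp
  then obtain a b d where "sorted_list_of_set S = [a, b, d]"
    unfolding length_Suc_conv by auto
  with strict_sorted_list_of_set[of S] set_sorted_list_of_set[OF fin] show ?thesis
    by (intro that[of a b d]) auto
qed

lemma card_4_nat_sorted: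
  fixes S :: "nat set"
  assumes "card S = 4"
  obtains a b c d where "a < b" "b < c" "c < d" "S = {a, b, c, d}"
proof -
  have fin: "finite S" using assms by (intro card_ge_0_finite) simp
  have "length (sorted_list_of_set S) = Suc (Suc (Suc (Suc 0)))" using assms by simp
  then obtain a b c d where "sorted_list_of_set S = [a, b, c, d]"
    unfolding length_Suc_conv by auto
  with strict_sorted_list_of_set[of S] set_sorted_list_of_set[OF fin] show ?thesis
    by (intro that[of a b c d]) auto
qed

lemma pair_union_inj:
  fixes i j i' j' :: nat
  assumes "Suc i < j" "Suc i' < j'" "{i, Suc i, j, Suc j} \<subseteq> {i', Suc i', j', Suc j'}"
  shows "i = i' \<and> j = j'"
  using assms by auto

lemma quadratic_three_roots:
  fixes A B C :: real
  assumes "A * a\<^sup>2 + B * a + C = 0" "A * b\<^sup>2 + B * b + C = 0" "A * d\<^sup>2 + B * d + C = 0"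
    "a \<noteq> b" "b \<noteq> d" "a \<noteq> d"
  shows "A = 0 \<and> B = 0 \<and> C = 0"
proof -
  have "(a - b) * (A * (a + b) + B) = 0" using assms(1,2) by algebra
  hence 1: "A * (a + b) + B = 0" using assms(4) by simp
  have "(b - d) * (A * (b + d) + B) = 0" using assms(2,3) by algebra
  hence 2: "A * (b + d) + B = 0" using assms(5) by simp
  have "A * (a - d) = 0" using 1 2 by algebra
  hence "A = 0" using assms(6) by simp
  with 1 assms(1) show ?thesis by simp
qed

lemma quartic_factor_three_roots:
  fixes c0 c1 c2 c3 c4 a b d :: real
  defines "p \<equiv> \<lambda>t. c4 * t^4 + c3 * t^3 + c2 * t\<^sup>2 + c1 * t + c0"
  assumes "p a = 0" "p b = 0" "p d = 0" "a \<noteq> b" "b \<noteq> d" "a \<noteq> d"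
  shows "p t = (t - a) * (t - b) * (t - d) * (c4 * (t + a + b + d) + c3)"
proof -
  define A where "A = c2 - (c4 * (a*b + a*d + b*d) - (a + b + d) * (c4 * (a + b + d) + c3))"
  define B where "B = c1 - ((a*b + a*d + b*d) * (c4 * (a + b + d) + c3) - a*b*d * c4)"
  define C where "C = c0 + a*b*d * (c4 * (a + b + d) + c3)"
  have *: "p t = (t - a) * (t - b) * (t - d) * (c4 * (t + a + b + d) + c3) + (A * t\<^sup>2 + B * t + C)" for t
    unfolding p_def A_def B_def C_def by (simp add: algebra_simps power_def numeral_eq_Suc)
  have "A = 0 \<and> B = 0 \<and> C = 0"
    using *[of a] *[of b] *[of d] assms(2-)
    by (intro quadratic_three_roots[of A a B C b d]) simp_all
  with *[of t] show ?thesis by simp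
qed

text \<open>The facts on which the realization rests: the order of the parameters, the signs of
  four-term sums as decided by the extreme indices, and positive denominators. \<open>G_1m\<close>
  expresses that the ideal reaches the last vertex \<open>m\<close>.\<close>

locale squeezed_curve =
  fixes m :: nat and G :: "nat \<Rightarrow> nat \<Rightarrow> bool" and t :: "nat \<Rightarrow> real" and M :: real
  assumes m: "4 \<le> m" and G_1m: "G 1 m"
    and down: "\<And>a b a' b'. \<lbrakk>G a b; a' \<le> a; b' \<le> b\<rbrakk> \<Longrightarrow> G a' b'"
    and t_mono: "\<And>a b. \<lbrakk>1 \<le> a; a < b; b \<le> m\<rbrakk> \<Longrightarrow> t a < t b"
    and t_neg: "\<And>a b c d. \<lbrakk>1 \<le> a; a \<le> b; b \<le> c; c \<le> d; d \<le> m; G a d\<rbrakk> \<Longrightarrow> t a + t b + t c + t d < 0"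
    and t_pos: "\<And>a b c d. \<lbrakk>1 \<le> a; a \<le> b; b \<le> c; c \<le> d; d \<le> m; \<not> G a d\<rbrakk> \<Longrightarrow> t a + t b + t c + t d > 0"
    and weight_pos: "\<And>k. \<lbrakk>1 \<le> k; k \<le> m\<rbrakk> \<Longrightarrow> 0 < M + t k ^ 3"
begin

section \<open>Base quadruples and their boundary triangles\<close>

definition good :: "nat \<Rightarrow> nat \<Rightarrow> bool" where
  "good i j \<longleftrightarrow> 1 \<le> i \<and> Suc i < j \<and> Suc j \<le> m \<and> G i (Suc j)"

text \<open>All ball facets contain the apex, so the ball is a cone over the complex of the good
  quadruples. A triangle in exactly one quadruple is a boundary triangle of this base; joined to the
  apex it gives a facet of the sphere.\<close>

definition ridge :: "nat \<Rightarrow> nat \<Rightarrow> nat \<Rightarrow> bool" where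
  "ridge a b d \<longleftrightarrow> (\<exists>i j. good i j \<and> {a, b, d} \<subseteq> {i, Suc i, j, Suc j} \<and>
     (\<forall>i' j'. good i' j' \<and> {a, b, d} \<subseteq> {i', Suc i', j', Suc j'} \<longrightarrow> i' = i \<and> j' = j))"

text \<open>
  The sign conditions under which the quartic with roots \<open>t a, t b, t d\<close> and no cubic term, that is, with
  fourth root \<open>- (t a + t b + t d)\<close>, is positive (negative) at \<open>t k\<close>.
\<close>

definition ridge_pos :: "nat \<Rightarrow> nat \<Rightarrow> nat \<Rightarrow> nat \<Rightarrow> bool" where
  "ridge_pos a b d k \<longleftrightarrow> (k < a \<longrightarrow> G k d) \<and> (a < k \<and> k < b \<longrightarrow> \<not> G a d) \<and>
     (b < k \<and> k < d \<longrightarrow> G a d) \<and> (d < k \<longrightarrow> \<not> G a k)"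

definition ridge_neg :: "nat \<Rightarrow> nat \<Rightarrow> nat \<Rightarrow> nat \<Rightarrow> bool" where
  "ridge_neg a b d k \<longleftrightarrow> (k < a \<longrightarrow> \<not> G k d) \<and> (a < k \<and> k < b \<longrightarrow> G a d) \<and>
     (b < k \<and> k < d \<longrightarrow> \<not> G a d) \<and> (d < k \<longrightarrow> G a k)"

lemma G_1: "k \<le> m \<Longrightarrow> G 1 k"
  using down[OF G_1m] by blast

lemma t_eq_iff: "\<lbrakk>1 \<le> a; a \<le> m; 1 \<le> b; b \<le> m\<rbrakk> \<Longrightarrow> t a = t b \<longleftrightarrow> a = b"
  using t_mono by (metis less_irrefl linorder_neqE_nat)

text \<open>A triangle omits one element of its quadruple, and the neighbouring quadruple across it
  is not good. If \<open>i\<close> or \<open>j\<close> is omitted, that neighbour lies above, and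
  its absence gives the positive pattern. If \<open>Suc i\<close> or \<open>Suc j\<close> is
  omitted, it lies below and would be good by downward closure, unless the triangle is
  \<open>{1, b, Suc b}\<close>; these are the negative ones.\<close>

lemma ridge_imp_sign:
  assumes "ridge a b d" "1 \<le> a" "a < b" "b < d" "d \<le> m"
  shows "(\<forall>k\<in>{1..m}. ridge_pos a b d k) \<or> (\<forall>k\<in>{1..m}. ridge_neg a b d k)"
proof -
  from assms(1)[unfolded ridge_def] obtain i j where *: "good i j \<and> {a, b, d} \<subseteq> {i, Suc i, j, Suc j} \<and>
     (\<forall>i' j'. good i' j' \<and> {a, b, d} \<subseteq> {i', Suc i', j', Suc j'} \<longrightarrow> i' = i \<and> j' = j)"
    by (elim exE) (rule that)
  note ij = conjunct1[OF *] conjunct1[OF conjunct2[OF *]]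
  have uniq: "i' = i \<and> j' = j" if "good i' j'" "{a, b, d} \<subseteq> {i', Suc i', j', Suc j'}" for i' j'
    using conjunct2[OF conjunct2[OF *], rule_format, OF conjI[OF that]] .
  have g: "1 \<le> i" "Suc i < j" "Suc j \<le> m" "G i (Suc j)" using ij(1) by (auto simp: good_def)
  have G_le: "G k l" if "k \<le> i" "l \<le> Suc j" for k l using down[OF g(4)] that by blast
  consider "a = Suc i" "b = j" "d = Suc j" | "a = i" "b = j" "d = Suc j"
    | "a = i" "b = Suc i" "d = Suc j" | "a = i" "b = Suc i" "d = j"
  proof -
    have abd: "a \<in> {i, Suc i, j, Suc j}" "b \<in> {i, Suc i, j, Suc j}" "d \<in> {i, Suc i, j, Suc j}"
      using ij(2) by auto
    have "b \<noteq> i" "b \<noteq> Suc j" using abd(1,3) assms(3,4) g(2) by auto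
    with abd(2) have b: "b = Suc i \<or> b = j" by blast
    have "a \<noteq> j" "a \<noteq> Suc j" using b assms(3) g(2) by auto
    with abd(1) have a: "a = i \<or> a = Suc i" by blast
    have "d \<noteq> i" "d \<noteq> Suc i" using b assms(4) a assms(3) g(2) by auto
    with abd(3) have d: "d = j \<or> d = Suc j" by blast
    show thesis using a b d assms(3,4) g(2) that by (elim disjE) simp_all
  qed
  thus ?thesis
  proof cases
    case 1
    have "\<not> G a (Suc d)" if "Suc d \<le> m"
    \<comment> \<open>In the first case the edges starting at \<open>Suc i\<close> and
      \<open>j\<close> overlap, so the neighbour is given by \<open>Suc i\<close> and
      \<open>Suc j\<close> instead.\<close>
    proof (cases "j = Suc (Suc i)")
      case True
      have "\<not> good (Suc i) (Suc j)" using uniq[of "Suc i" "Suc j"] 1 True by auto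
      thus ?thesis using 1 True that g by (auto simp: good_def)
    next
      case False
      have "\<not> good (Suc i) j" using uniq[of "Suc i" j] 1 by auto
      hence "\<not> G a d" using 1 False g by (auto simp: good_def)
      thus ?thesis using down[of a "Suc d" a d] by auto
    qed
    moreover have "\<not> G a d" if "j \<noteq> Suc (Suc i)"
    proof -
      have "\<not> good (Suc i) j" using uniq[of "Suc i" j] 1 by auto
      thus ?thesis using 1 that g by (auto simp: good_def)
    qed
    ultimately have "ridge_pos a b d k" if "k \<in> {1..m}" for k
      using 1 that g G_le down[of a k a "Suc d"] by (fastforce simp: ridge_pos_def)
    thus ?thesis by blast
  next
    case 2
    have "i = 1"
    proof (rule ccontr)
      assume "i \<noteq> 1"
      hence "good (i - 1) j" using g G_le[of "i - 1" "Suc j"] by (auto simp: good_def)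
      from uniq[OF this] 2 g show False by auto
    qed
    hence "ridge_neg a b d k" if "k \<in> {1..m}" for k
      using 2 that G_1 g by (auto simp: ridge_neg_def)
    thus ?thesis by blast
  next
    case 3
    have "\<not> G a (Suc d)" if "Suc d \<le> m"
    proof -
      have "\<not> good i (Suc j)" using uniq[of i "Suc j"] 3 by auto
      thus ?thesis using 3 that g by (auto simp: good_def)
    qed
    hence "ridge_pos a b d k" if "k \<in> {1..m}" for k
      using 3 that g G_le down[of a k a "Suc d"] by (fastforce simp: ridge_pos_def)
    thus ?thesis by blast
  next
    case 4
    have j: "j = Suc (Suc i)"
    proof (rule ccontr)
      assume "j \<noteq> Suc (Suc i)"
      hence "good i (j - 1)" using g G_le[of i j] by (auto simp: good_def)
      from uniq[OF this] 4 g show False by auto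
    qed
    \<comment> \<open>The triangle now consists of three consecutive numbers and also lies in the
      quadruple of \<open>i - 1\<close> and \<open>Suc i\<close>.\<close>
    have "i = 1"
    proof (rule ccontr)
      assume "i \<noteq> 1"
      hence "good (i - 1) (Suc i)" using g j G_le[of "i - 1" "Suc (Suc i)"] by (auto simp: good_def)
      from uniq[OF this] 4 g j show False by auto
    qed
    hence "ridge_neg a b d k" if "k \<in> {1..m}" for k
      using 4 j that G_1 g by (auto simp: ridge_neg_def)
    thus ?thesis by blast
  qed
qed

lemma ridgeI:
  assumes "good i j" "{a, b, d} \<subseteq> {i, Suc i, j, Suc j}"
    "\<And>i' j'. \<lbrakk>good i' j'; {a, b, d} \<subseteq> {i', Suc i', j', Suc j'}\<rbrakk> \<Longrightarrow> i' = i \<and> j' = j"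
  shows "ridge a b d"
  unfolding ridge_def by (rule exI[of _ i], rule exI[of _ j]) (intro conjI assms allI impI; elim conjE; simp only: assms)

text \<open>As in Gale's evenness condition, a gap where the sign would be wrong must be empty:
  \<open>G a d\<close> forces \<open>b = Suc a\<close>, its failure forces \<open>d = Suc b\<close>.
  The conditions below \<open>a\<close> and above \<open>d\<close> then leave one good quadruple
  among the candidates.\<close>

lemma ridge_if_pos:
  assumes pos: "\<And>k. \<lbrakk>1 \<le> k; k \<le> m\<rbrakk> \<Longrightarrow> ridge_pos a b d k" and le: "1 \<le> a" "a < b" "b < d" "d \<le> m"
  shows "ridge a b d"
proof (cases "G a d")
  case True
  have b: "b = Suc a" using pos[of "Suc a"] True le by (auto simp: ridge_pos_def)
  have n: "\<not> G a k" if "Suc d \<le> k" "k \<le> m" for k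
    using pos[of k] that le by (auto simp: ridge_pos_def)
  show ?thesis
  proof (cases "d = Suc b")
    case d: True
    \<comment> \<open>For \<open>a = 1\<close> the triangle would be \<open>{1, 2, 3}\<close>, and
      \<open>n\<close> at the vertex 4 would contradict \<open>G_1\<close>.\<close>
    have "a \<noteq> 1" using n[of 4] m G_1[of 4] d b by auto
    hence "good (a - 1) b" using le True b d down[of a d "a - 1" "Suc b"] by (auto simp: good_def)
    moreover have "\<not> good a d" using n[of "Suc d"] by (auto simp: good_def)
    ultimately show ?thesis using le b d \<open>a \<noteq> 1\<close>
      by (intro ridgeI[of "a - 1" b]) (auto simp: good_def)
  next
    case False
    hence "good a (d - 1)" using le True b by (auto simp: good_def)
    moreover have "\<not> good a d" using n[of "Suc d"] by (auto simp: good_def)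
    ultimately show ?thesis using le b False
      by (intro ridgeI[of a "d - 1"]) (auto simp: good_def)
  qed
next
  case False
  have d: "d = Suc b" using pos[of "Suc b"] False le by (auto simp: ridge_pos_def)
  have a: "a \<noteq> 1" using False G_1[of d] le by auto
  hence G: "G (a - 1) d" using pos[of "a - 1"] le by (auto simp: ridge_pos_def)
  hence "good (a - 1) b" using a le d by (auto simp: good_def)
  moreover have "\<not> good a b" "\<not> good a d"
    using False d down[of a "Suc d" a d] by (auto simp: good_def)
  ultimately show ?thesis using le d a
    by (intro ridgeI[of "a - 1" b]) (auto simp: good_def)
qed

text \<open>As \<open>G 1 d\<close> holds, vertex 1 cannot lie below \<open>a\<close>, so
  \<open>a = 1\<close>; likewise nothing lies between \<open>b\<close> and \<open>d\<close>. What
  remains is \<open>{1, b, Suc b}\<close>, whose only quadruple starts with \<open>1, 2\<close>; for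
  \<open>b = 2\<close> its upper edge is \<open>3, 4\<close>.\<close>

lemma ridge_if_neg:
  assumes neg: "\<And>k. \<lbrakk>1 \<le> k; k \<le> m\<rbrakk> \<Longrightarrow> ridge_neg a b d k" and le: "1 \<le> a" "a < b" "b < d" "d \<le> m"
  shows "ridge a b d"
proof -
  have a: "a = 1" using neg[of 1] G_1[of d] le by (force simp: ridge_neg_def)
  have d: "d = Suc b" using neg[of "Suc b"] G_1[of d] a le by (force simp: ridge_neg_def)
  show ?thesis
  proof (cases "b = 2")
    case True
    thus ?thesis using a d m G_1[of 4]
      by (intro ridgeI[of 1 3]) (auto simp: good_def)
  next
    case False
    thus ?thesis using a d le G_1[of d]
      by (intro ridgeI[of 1 b]) (auto simp: good_def)
  qed
qed

section \<open>Signs of the quartics attached to triangles\<close>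

lemma sum_sign:
  assumes "1 \<le> k" "k \<le> m" "1 \<le> a" "a < b" "b < d" "d \<le> m"
  shows "G (min a k) (max d k) \<Longrightarrow> t k + t a + t b + t d < 0"
    and "\<not> G (min a k) (max d k) \<Longrightarrow> t k + t a + t b + t d > 0"
proof -
  consider "k \<le> a" | "a \<le> k" "k \<le> b" | "b \<le> k" "k \<le> d" | "d \<le> k" by linarith
  hence "(G (min a k) (max d k) \<longrightarrow> t k + t a + t b + t d < 0) \<and>
      (\<not> G (min a k) (max d k) \<longrightarrow> t k + t a + t b + t d > 0)"
  proof cases
    case 1
    thus ?thesis using t_neg[of k a b d] t_pos[of k a b d] assms by (auto simp: min_def max_def)
  next
    case 2
    thus ?thesis using t_neg[of a k b d] t_pos[of a k b d] assms by (auto simp: min_def max_def)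
  next
    case 3
    thus ?thesis using t_neg[of a b k d] t_pos[of a b k d] assms by (auto simp: min_def max_def)
  next
    case 4
    thus ?thesis using t_neg[of a b d k] t_pos[of a b d k] assms by (auto simp: min_def max_def)
  qed
  thus "G (min a k) (max d k) \<Longrightarrow> t k + t a + t b + t d < 0"
    and "\<not> G (min a k) (max d k) \<Longrightarrow> t k + t a + t b + t d > 0" by blast+
qed

definition ridge_quartic :: "nat \<Rightarrow> nat \<Rightarrow> nat \<Rightarrow> real \<Rightarrow> real" where
  "ridge_quartic a b d s = (s - t a) * (s - t b) * (s - t d) * (s + t a + t b + t d)"

text \<open>The first three factors change sign at \<open>t a\<close>, \<open>t b\<close>,
  \<open>t d\<close>, and \<open>sum_sign\<close> gives the sign of the last. The patterns
  \<open>ridge_pos\<close> and \<open>ridge_neg\<close> list the outcome on each of the four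
  intervals.\<close>

lemma ridge_quartic_sign:
  assumes k: "1 \<le> k" "k \<le> m" "k \<noteq> a" "k \<noteq> b" "k \<noteq> d" and le: "1 \<le> a" "a < b" "b < d" "d \<le> m"
  shows "ridge_quartic a b d (t k) > 0 \<longleftrightarrow> ridge_pos a b d k"
    and "ridge_quartic a b d (t k) < 0 \<longleftrightarrow> ridge_neg a b d k"
proof -
  define N where "N = (t k - t a) * (t k - t b) * (t k - t d)"
  define S where "S = t k + t a + t b + t d"
  have S: "S < 0 \<longleftrightarrow> G (min a k) (max d k)" "S > 0 \<longleftrightarrow> \<not> G (min a k) (max d k)"
    using sum_sign[OF k(1,2) le] unfolding S_def by (metis less_asym)+
  have q: "ridge_quartic a b d (t k) = N * S"
    by (simp add: ridge_quartic_def N_def S_def)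
  consider "k < a" | "a < k" "k < b" | "b < k" "k < d" | "d < k" using k by linarith
  hence "(ridge_quartic a b d (t k) > 0 \<longleftrightarrow> ridge_pos a b d k) \<and>
      (ridge_quartic a b d (t k) < 0 \<longleftrightarrow> ridge_neg a b d k)"
  proof cases
    case 1
    hence "t k < t a" "t k < t b" "t k < t d" using k le by (auto intro: t_mono)
    hence "N < 0" unfolding N_def by (simp add: mult_less_0_iff zero_less_mult_iff)
    with S 1 le show ?thesis unfolding q
      by (auto simp: mult_less_0_iff zero_less_mult_iff ridge_pos_def ridge_neg_def min_def max_def)
  next
    case 2
    hence "t k > t a" "t k < t b" "t k < t d" using k le by (auto intro: t_mono)
    hence "N > 0" unfolding N_def by (simp add: mult_less_0_iff zero_less_mult_iff)
    with S 2 le show ?thesis unfolding q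
      by (auto simp: mult_less_0_iff zero_less_mult_iff ridge_pos_def ridge_neg_def min_def max_def)
  next
    case 3
    hence "t k > t a" "t k > t b" "t k < t d" using k le by (auto intro: t_mono)
    hence "N < 0" unfolding N_def by (simp add: mult_less_0_iff zero_less_mult_iff)
    with S 3 le show ?thesis unfolding q
      by (auto simp: mult_less_0_iff zero_less_mult_iff ridge_pos_def ridge_neg_def min_def max_def)
  next
    case 4
    hence "t k > t a" "t k > t b" "t k > t d" using k le by (auto intro: t_mono)
    hence "N > 0" unfolding N_def by (simp add: mult_less_0_iff zero_less_mult_iff)
    with S 4 le show ?thesis unfolding q
      by (auto simp: mult_less_0_iff zero_less_mult_iff ridge_pos_def ridge_neg_def min_def max_def)
  qed
  thus "ridge_quartic a b d (t k) > 0 \<longleftrightarrow> ridge_pos a b d k"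
    and "ridge_quartic a b d (t k) < 0 \<longleftrightarrow> ridge_neg a b d k" by blast+
qed

section \<open>The embedding and the polynomials behind affine functionals\<close>

text \<open>In homogeneous coordinates the curve is \<open>(1, s, s^2, s^3, s^4)\<close>. The third
  moment, shifted by \<open>M\<close>, serves as denominator and so is missing from the vector; the
  apex, the unit vector of that coordinate, goes to the origin.\<close>

definition point :: "nat \<Rightarrow> real ^ 4" where
  "point k = (if k = 0 then 0 else (1 / (M + t k ^ 3)) *\<^sub>R vec4 1 (t k) ((t k)\<^sup>2) (t k ^ 4))"

text \<open>Clearing the denominator turns an affine functional into a quartic whose cubic
  coefficient \<open>b\<close> is also the value of the functional at the apex.\<close>

lemma inner_point:
  assumes "1 \<le> k" "k \<le> m"
  shows "(b - a \<bullet> point k) * (M + t k ^ 3) =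
    (- (a $ 4)) * t k ^ 4 + b * t k ^ 3 + (- (a $ 3)) * (t k)\<^sup>2 + (- (a $ 2)) * t k + (b * M - a $ 1)"
  using weight_pos[OF assms] assms
  by (simp add: point_def inner_vec4 field_simps)

lemma ex_functional:
  "\<exists>a b. b - a \<bullet> point 0 = c3 \<and> (\<forall>k. 1 \<le> k \<and> k \<le> m \<longrightarrow>
     b - a \<bullet> point k = (c4 * t k ^ 4 + c3 * t k ^ 3 + c2 * (t k)\<^sup>2 + c1 * t k + c0) / (M + t k ^ 3))"
\<comment> \<open>The witnesses solve for the coefficients in \<open>inner_point\<close>; its
  constant term \<open>b * M - a $ 1\<close> yields the entry \<open>c3 * M - c0\<close>.\<close>
proof (intro exI[of _ c3] exI[of _ "vec4 (c3 * M - c0) (- c1) (- c2) (- c4)"] conjI allI impI)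
  show "c3 - vec4 (c3 * M - c0) (- c1) (- c2) (- c4) \<bullet> point 0 = c3" by (simp add: point_def)
  fix k assume "1 \<le> k \<and> k \<le> m"
  with inner_point[of k c3 "vec4 (c3 * M - c0) (- c1) (- c2) (- c4)"] weight_pos[of k]
  show "c3 - vec4 (c3 * M - c0) (- c1) (- c2) (- c4) \<bullet> point k =
      (c4 * t k ^ 4 + c3 * t k ^ 3 + c2 * (t k)\<^sup>2 + c1 * t k + c0) / (M + t k ^ 3)"
    by (simp add: vec4_nth eq_divide_eq)
qed

text \<open>By Vieta the cubic coefficient, hence the value at the apex, is minus the leading
  coefficient times the sum of the roots.\<close>

lemma ex_functional_quartic:
  "\<exists>a b. b - a \<bullet> point 0 = - c * (p + q + r + s) \<and> (\<forall>k. 1 \<le> k \<and> k \<le> m \<longrightarrow>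
     b - a \<bullet> point k = c * ((t k - p) * (t k - q) * (t k - r) * (t k - s)) / (M + t k ^ 3))"
proof -
  have "c * ((x - p) * (x - q) * (x - r) * (x - s)) = c * x ^ 4 + (- c * (p + q + r + s)) * x ^ 3
      + (c * (p*q + p*r + p * s + q*r + q * s + r * s)) * x\<^sup>2
      + (- c * (p*q*r + p*q * s + p*r * s + q*r * s)) * x + c*p*q*r * s" for x
    by (simp add: algebra_simps power_def numeral_eq_Suc)
  thus ?thesis by (simp only: ex_functional)
qed

lemma ex_functional_cubic:
  "\<exists>a b. b - a \<bullet> point 0 = 1 \<and> (\<forall>k. 1 \<le> k \<and> k \<le> m \<longrightarrow>
     b - a \<bullet> point k = ((t k - p) * (t k - q) * (t k - r)) / (M + t k ^ 3))"
proof -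
  have "(x - p) * (x - q) * (x - r) = 0 * x ^ 4 + 1 * x ^ 3
      + (- (p + q + r)) * x\<^sup>2 + (p*q + p*r + q*r) * x + (- p*q*r)" for x
    by (simp add: algebra_simps power_def numeral_eq_Suc)
  thus ?thesis by (simp only: ex_functional)
qed

lemma ex_functional_quadratic:
  "\<exists>a b. b - a \<bullet> point 0 = 0 \<and> (\<forall>k. 1 \<le> k \<and> k \<le> m \<longrightarrow>
     b - a \<bullet> point k = ((t k - p) * (t k - q)) / (M + t k ^ 3))"
proof -
  have "(x - p) * (x - q) = 0 * x ^ 4 + 0 * x ^ 3 + 1 * x\<^sup>2 + (- (p + q)) * x + p*q" for x
    by (simp add: algebra_simps power_def numeral_eq_Suc)
  thus ?thesis by (simp only: ex_functional)
qed

section \<open>Facets of the boundary sphere and their supporting hyperplanes\<close>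

definition ball_facets :: "nat set set" where
  "ball_facets = {{0, i, Suc i, j, Suc j} | i j. good i j}"

definition sphere_facets :: "nat set set" where
  "sphere_facets = {r. card r = 4 \<and> (\<exists>!f. f \<in> ball_facets \<and> r \<subseteq> f)}"

lemma ball_facet_inj:
  assumes "good i j" "good i' j'" "{i, Suc i, j, Suc j} \<subseteq> {0, i', Suc i', j', Suc j'}"
  shows "i = i' \<and> j = j'"
proof (rule pair_union_inj)
  show "{i, Suc i, j, Suc j} \<subseteq> {i', Suc i', j', Suc j'}"
    using assms(1,3) by (auto simp: good_def)
qed (use assms in \<open>auto simp: good_def\<close>)

lemma card_good: "good i j \<Longrightarrow> card {i, Suc i, j, Suc j} = 4"
  by (simp add: good_def)

text \<open>A facet without the apex fills a whole base quadruple. With the apex, its other three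
  vertices form a triangle, and uniqueness of the ball facet becomes uniqueness of the
  quadruple.\<close>

lemma sphere_facet_cases:
  assumes "r \<in> sphere_facets"
  obtains i j where "good i j" "r = {i, Suc i, j, Suc j}"
  | a b d where "1 \<le> a" "a < b" "b < d" "d \<le> m" "r = {0, a, b, d}" "ridge a b d"
proof -
  from assms have c: "card r = 4" and ex1: "\<exists>!f. f \<in> ball_facets \<and> r \<subseteq> f"
    by (auto simp: sphere_facets_def)
  from ex1 obtain i j where ij: "good i j" "r \<subseteq> {0, i, Suc i, j, Suc j}"
    by (auto simp: ball_facets_def)
  from ex1 obtain f0 where f0: "\<And>f. f \<in> ball_facets \<and> r \<subseteq> f \<Longrightarrow> f = f0"
    by (elim ex1E) iprover
  show thesis
  proof (cases "0 \<in> r")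
    case False
    hence "r \<subseteq> {i, Suc i, j, Suc j}" using ij(2) by auto
    hence "r = {i, Suc i, j, Suc j}" using c card_good[OF ij(1)] by (intro card_subset_eq) auto
    thus thesis using that(1) ij(1) by blast
  next
    case True
    hence "card (r - {0}) = 3" using c by simp
    then obtain a b d where abd: "a < b" "b < d" "r - {0} = {a, b, d}"
      by (rule card_3_nat_sorted)
    hence r: "r = {0, a, b, d}" using True by blast
    have a: "1 \<le> a" using abd(3) by (cases a) auto
    have sub: "{a, b, d} \<subseteq> {i, Suc i, j, Suc j}" using r ij(2) a abd(1,2) by auto
    hence "d \<le> m" using ij(1) by (auto simp: good_def)
    moreover have "ridge a b d"
    proof (rule ridgeI[OF ij(1) sub])
      fix i' j' assume *: "good i' j'" "{a, b, d} \<subseteq> {i', Suc i', j', Suc j'}"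
      hence 1: "{0, i', Suc i', j', Suc j'} \<in> ball_facets \<and> r \<subseteq> {0, i', Suc i', j', Suc j'}"
        unfolding ball_facets_def r by blast
      have 2: "{0, i, Suc i, j, Suc j} \<in> ball_facets \<and> r \<subseteq> {0, i, Suc i, j, Suc j}"
        using ij unfolding ball_facets_def by blast
      have "{0, i', Suc i', j', Suc j'} = {0, i, Suc i, j, Suc j}"
        by (rule trans[OF f0[OF 1] f0[OF 2, symmetric]])
      hence "{i', Suc i', j', Suc j'} \<subseteq> {0, i, Suc i, j, Suc j}"
        using subset_insertI by (rule subst)
      from ball_facet_inj[OF *(1) ij(1) this] show "i' = i \<and> j' = j" .
    qed
    ultimately show thesis using that(2)[OF a abd(1,2)] r by iprover
  qed
qed

lemma sphere_facet_if_good: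
  assumes "good i j"
  shows "{i, Suc i, j, Suc j} \<in> sphere_facets"
proof -
  have "\<exists>!f. f \<in> ball_facets \<and> {i, Suc i, j, Suc j} \<subseteq> f"
  proof (rule ex1I[of _ "{0, i, Suc i, j, Suc j}"])
    show "{0, i, Suc i, j, Suc j} \<in> ball_facets \<and> {i, Suc i, j, Suc j} \<subseteq> {0, i, Suc i, j, Suc j}"
      using assms unfolding ball_facets_def by blast
    fix f assume "f \<in> ball_facets \<and> {i, Suc i, j, Suc j} \<subseteq> f"
    then obtain i' j' where f: "good i' j'" "f = {0, i', Suc i', j', Suc j'}"
        "{i, Suc i, j, Suc j} \<subseteq> f"
      unfolding ball_facets_def by blast
    with ball_facet_inj[OF assms f(1)] show "f = {0, i, Suc i, j, Suc j}" by blast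
  qed
  with card_good[OF assms] show ?thesis by (simp add: sphere_facets_def)
qed

lemma sphere_facet_if_ridge:
  assumes r: "ridge a b d" and le: "1 \<le> a" "a < b" "b < d"
  shows "{0, a, b, d} \<in> sphere_facets"
proof -
  from r[unfolded ridge_def] obtain i j where *: "good i j \<and> {a, b, d} \<subseteq> {i, Suc i, j, Suc j} \<and>
     (\<forall>i' j'. good i' j' \<and> {a, b, d} \<subseteq> {i', Suc i', j', Suc j'} \<longrightarrow> i' = i \<and> j' = j)"
    by (elim exE) (rule that)
  note ij = conjunct1[OF *] conjunct1[OF conjunct2[OF *]]
  note uniq = conjunct2[OF conjunct2[OF *], rule_format, OF conjI]
  have "\<exists>!f. f \<in> ball_facets \<and> {0, a, b, d} \<subseteq> f"
  proof (rule ex1I[of _ "{0, i, Suc i, j, Suc j}"])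
    show "{0, i, Suc i, j, Suc j} \<in> ball_facets \<and> {0, a, b, d} \<subseteq> {0, i, Suc i, j, Suc j}"
      using ij unfolding ball_facets_def by blast
    fix f assume "f \<in> ball_facets \<and> {0, a, b, d} \<subseteq> f"
    then obtain i' j' where f: "good i' j'" "f = {0, i', Suc i', j', Suc j'}" "{0, a, b, d} \<subseteq> f"
      unfolding ball_facets_def by blast
    have "{a, b, d} \<subseteq> {i', Suc i', j', Suc j'}" using f(2,3) le by auto
    with uniq[OF f(1)] f(2) show "f = {0, i, Suc i, j, Suc j}" by blast
  qed
  with le show ?thesis by (simp add: sphere_facets_def)
qed

lemma sphere_facet_subset:
  assumes "r \<in> sphere_facets"
  shows "r \<subseteq> {0..m}"
  using assms by (cases rule: sphere_facet_cases) (auto simp: good_def)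

text \<open>For a base quadruple, the quartic with these four roots is positive at the other
  parameters because the roots come in consecutive pairs; its apex value is minus a negative sum.
  For a facet with apex, a multiple of the ridge quartic vanishes at the apex and has one sign at
  all other vertices.\<close>

lemma sphere_facet_supporting:
  assumes "r \<in> sphere_facets"
  shows "\<exists>a b. (\<forall>k\<in>r. a \<bullet> point k = b) \<and> (\<forall>k\<in>{0..m} - r. a \<bullet> point k < b)"
  using assms
proof (cases rule: sphere_facet_cases)
  case (1 i j)
  hence g: "1 \<le> i" "Suc i < j" "Suc j \<le> m" "G i (Suc j)" by (auto simp: good_def)
  obtain a b where ab: "b - a \<bullet> point 0 = - 1 * (t i + t (Suc i) + t j + t (Suc j))"
    "\<And>k. 1 \<le> k \<and> k \<le> m \<Longrightarrow> b - a \<bullet> point k =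
       1 * ((t k - t i) * (t k - t (Suc i)) * (t k - t j) * (t k - t (Suc j))) / (M + t k ^ 3)"
    using ex_functional_quartic[of 1 "t i" "t (Suc i)" "t j" "t (Suc j)"] by blast
  show ?thesis
  proof (intro exI[of _ a] exI[of _ b] conjI ballI)
    fix k assume "k \<in> r"
    thus "a \<bullet> point k = b" using ab(2)[of k] 1 g by auto
  next
    fix k assume k: "k \<in> {0..m} - r"
    show "a \<bullet> point k < b"
    proof (cases "k = 0")
      case True
      thus ?thesis using ab(1) t_neg[of i "Suc i" j "Suc j"] g by simp
    next
      case False
      hence k1: "1 \<le> k" "k \<le> m" using k by auto
      have "(t k - t i) * (t k - t (Suc i)) > 0"
      proof (cases "k < i")
        case True
        thus ?thesis using t_mono[of k i] t_mono[of k "Suc i"] k1 g by (simp add: zero_less_mult_iff)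
      next
        case False
        hence "k > Suc i" using k 1 by auto
        thus ?thesis using t_mono[of i k] t_mono[of "Suc i" k] k1 g by (simp add: zero_less_mult_iff)
      qed
      moreover have "(t k - t j) * (t k - t (Suc j)) > 0"
      proof (cases "k < j")
        case True
        thus ?thesis using t_mono[of k j] t_mono[of k "Suc j"] k1 g by (simp add: zero_less_mult_iff)
      next
        case False
        hence "k > Suc j" using k 1 by auto
        thus ?thesis using t_mono[of j k] t_mono[of "Suc j" k] k1 g by (simp add: zero_less_mult_iff)
      qed
      ultimately have "0 < ((t k - t i) * (t k - t (Suc i))) * ((t k - t j) * (t k - t (Suc j)))"
        by (rule mult_pos_pos)
      hence "0 < b - a \<bullet> point k"
        using ab(2)[of k] k1 weight_pos[OF k1] by (simp add: mult.assoc)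
      thus ?thesis by simp
    qed
  qed
next
  case (2 a b d)
  \<comment> \<open>The orientation in which the quartic is positive off the facet.\<close>
  let ?c = "if \<forall>k\<in>{1..m}. ridge_pos a b d k then 1 else -1 :: real"
  have c: "?c * ridge_quartic a b d (t k) > 0"
    if "1 \<le> k" "k \<le> m" "k \<noteq> a" "k \<noteq> b" "k \<noteq> d" for k
    using ridge_imp_sign[OF 2(6,1-4)] ridge_quartic_sign[OF that 2(1-4)] that by auto
  obtain u v where uv: "v - u \<bullet> point 0 = - ?c * (t a + t b + t d + - (t a + t b + t d))"
    "\<And>k. 1 \<le> k \<and> k \<le> m \<Longrightarrow> v - u \<bullet> point k =
       ?c * ((t k - t a) * (t k - t b) * (t k - t d) * (t k - - (t a + t b + t d))) / (M + t k ^ 3)"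
    using ex_functional_quartic[of ?c "t a" "t b" "t d" "- (t a + t b + t d)"] by blast
  have uv2: "v - u \<bullet> point k = ?c * ridge_quartic a b d (t k) / (M + t k ^ 3)"
    if "1 \<le> k" "k \<le> m" for k
    using uv(2)[of k] that by (simp add: ridge_quartic_def add.assoc)
  show ?thesis
  proof (intro exI[of _ u] exI[of _ v] conjI ballI)
    fix k assume "k \<in> r"
    then consider "k = 0" | "k = a" | "k = b" | "k = d" using 2(5) by blast
    thus "u \<bullet> point k = v"
      using uv(1) uv2[of k] 2(1-4) by cases (auto simp: ridge_quartic_def)
  next
    fix k assume k: "k \<in> {0..m} - r"
    hence k: "1 \<le> k" "k \<le> m" "k \<noteq> a" "k \<noteq> b" "k \<noteq> d" using 2(5) by auto
    have "0 < v - u \<bullet> point k"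
      unfolding uv2[OF k(1,2)] using c[OF k] weight_pos[OF k(1,2)] by (rule divide_pos_pos)
    thus "u \<bullet> point k < v" by simp
  qed
qed

section \<open>Affine independence of the facets and completeness of their list\<close>

lemma separate_from_three:
  assumes "{k, p, q, r} \<subseteq> {1..m}" "k \<notin> {p, q, r}"
  shows "\<exists>a b. (\<forall>l\<in>{p, q, r}. a \<bullet> point l = b) \<and> a \<bullet> point k \<noteq> b"
proof -
  obtain a b where ab: "\<And>k. 1 \<le> k \<and> k \<le> m \<Longrightarrow> b - a \<bullet> point k =
      ((t k - t p) * (t k - t q) * (t k - t r)) / (M + t k ^ 3)"
    using ex_functional_cubic[of "t p" "t q" "t r"] by blast
  have "b - a \<bullet> point l = 0" if "l \<in> {p, q, r}" for l
    using ab[of l] that assms by auto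
  moreover have "b - a \<bullet> point k \<noteq> 0"
    using ab[of k] weight_pos[of k] assms t_eq_iff[of k p] t_eq_iff[of k q] t_eq_iff[of k r] by auto
  ultimately show ?thesis by (intro exI[of _ a] exI[of _ b]) auto
qed

text \<open>A quadratic has no cubic term and therefore vanishes at the apex.\<close>

lemma separate_from_apex_and_two:
  assumes "{k, p, q} \<subseteq> {1..m}" "k \<notin> {p, q}"
  shows "\<exists>a b. (\<forall>l\<in>{0, p, q}. a \<bullet> point l = b) \<and> a \<bullet> point k \<noteq> b"
proof -
  obtain a b where ab: "b - a \<bullet> point 0 = 0" "\<And>k. 1 \<le> k \<and> k \<le> m \<Longrightarrow> b - a \<bullet> point k =
      ((t k - t p) * (t k - t q)) / (M + t k ^ 3)"
    using ex_functional_quadratic[of "t p" "t q"] by blast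
  have "b - a \<bullet> point l = 0" if "l \<in> {0, p, q}" for l
    using ab(1) ab(2)[of l] that assms by auto
  moreover have "b - a \<bullet> point k \<noteq> 0"
    using ab(2)[of k] weight_pos[of k] assms t_eq_iff[of k p] t_eq_iff[of k q] by auto
  ultimately show ?thesis by (intro exI[of _ a] exI[of _ b]) auto
qed

text \<open>A monic cubic takes the value 1 at the apex.\<close>

lemma separate_apex_from_three:
  assumes "{p, q, r} \<subseteq> {1..m}"
  shows "\<exists>a b. (\<forall>l\<in>{p, q, r}. a \<bullet> point l = b) \<and> a \<bullet> point 0 \<noteq> b"
proof -
  obtain a b where ab: "b - a \<bullet> point 0 = 1" "\<And>k. 1 \<le> k \<and> k \<le> m \<Longrightarrow> b - a \<bullet> point k =
      ((t k - t p) * (t k - t q) * (t k - t r)) / (M + t k ^ 3)"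
    using ex_functional_cubic[of "t p" "t q" "t r"] by blast
  have "b - a \<bullet> point l = 0" if "l \<in> {p, q, r}" for l
    using ab(2)[of l] that assms by auto
  with ab(1) show ?thesis by (intro exI[of _ a] exI[of _ b]) auto
qed

lemma sphere_facet_independent:
  assumes "r \<in> sphere_facets" "k \<in> r"
  shows "\<exists>a b. (\<forall>l\<in>r - {k}. a \<bullet> point l = b) \<and> a \<bullet> point k \<noteq> b"
  using assms(1)
proof (cases rule: sphere_facet_cases)
  case (1 i j)
  hence r: "r \<subseteq> {1..m}" by (auto simp: good_def)
  have "card r = 4" using 1 card_good by simp
  hence "card (r - {k}) = 3" using assms(2) by simp
  then obtain p q s where s: "r - {k} = {p, q, s}" by (rule card_3_nat_sorted)
  thus ?thesis using separate_from_three[of k p q s] assms(2) r by blast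
next
  case (2 a b d)
  show ?thesis
  proof (cases "k = 0")
    case True
    hence "r - {k} = {a, b, d}" using 2 by auto
    thus ?thesis using separate_apex_from_three[of a b d] True 2 by auto
  next
    case False
    then consider "k = a" "r - {k} = {0, b, d}" | "k = b" "r - {k} = {0, a, d}"
      | "k = d" "r - {k} = {0, a, b}"
      using assms(2) 2 by fastforce
    thus ?thesis
    proof cases
      case 1
      show ?thesis unfolding 1(2) using 1(1) 2 by (intro separate_from_apex_and_two) auto
    next
      case B: 2
      show ?thesis unfolding B(2) using B(1) 2 by (intro separate_from_apex_and_two) auto
    next
      case 3
      show ?thesis unfolding 3(2) using 3(1) 2 by (intro separate_from_apex_and_two) auto
    qed
  qed
qed

text \<open>The slack \<open>v - u \<bullet> point k\<close> corresponds to a quartic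
  \<open>p\<close> that is nonnegative at all parameters. Off the apex, four roots and the positive
  apex value force the shape of a good quadruple; with the apex, three roots determine
  \<open>p\<close> up to a factor whose sign selects \<open>ridge_pos\<close> or
  \<open>ridge_neg\<close>.\<close>

lemma sphere_facets_complete:
  assumes nz: "u \<noteq> 0" and le: "\<forall>k\<in>{0..m}. u \<bullet> point k \<le> v"
    and card: "4 \<le> card {k\<in>{0..m}. u \<bullet> point k = v}"
  shows "\<exists>\<sigma>\<in>sphere_facets. {k\<in>{0..m}. u \<bullet> point k = v} \<subseteq> \<sigma>"
proof -
  define p where "p s = (- (u $ 4)) * s ^ 4 + v * s ^ 3 + (- (u $ 3)) * s\<^sup>2 + (- (u $ 2)) * s
    + (v * M - u $ 1)" for s
  define Z where "Z = {k\<in>{0..m}. u \<bullet> point k = v}"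
  have p: "(v - u \<bullet> point k) * (M + t k ^ 3) = p (t k)" if "1 \<le> k" "k \<le> m" for k
    unfolding p_def by (rule inner_point[OF that])
  have p_nonneg: "0 \<le> p (t k)" if "1 \<le> k" "k \<le> m" for k
    using p[OF that] weight_pos[OF that] le that by (metis atLeastAtMost_iff diff_ge_0_iff_ge
        le0 less_imp_le mult_nonneg_nonneg)
  have p_zero: "k \<in> Z \<longleftrightarrow> p (t k) = 0" if "1 \<le> k" "k \<le> m" for k
    using p[OF that] weight_pos[OF that] that unfolding Z_def by auto
  \<comment> \<open>The apex is the origin, so the slack there is \<open>v\<close> itself.\<close>
  have v: "0 \<le> v" "0 \<in> Z \<longleftrightarrow> v = 0" using bspec[OF le, of 0] unfolding Z_def by (auto simp: point_def)
  have factor: "p s = (s - t a) * (s - t b) * (s - t d) * (- (u $ 4) * (s + t a + t b + t d) + v)"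
    and not_both: "\<not> (u $ 4 = 0 \<and> v = 0)"
    if "a \<in> Z" "b \<in> Z" "d \<in> Z" "1 \<le> a" "a < b" "b < d" "d \<le> m" for a b d s
  proof -
    have z: "p (t a) = 0" "p (t b) = 0" "p (t d) = 0" "t a \<noteq> t b" "t b \<noteq> t d" "t a \<noteq> t d"
      using that p_zero t_eq_iff by auto
    show "p s = (s - t a) * (s - t b) * (s - t d) * (- (u $ 4) * (s + t a + t b + t d) + v)"
      using z unfolding p_def by (rule quartic_factor_three_roots)
    \<comment> \<open>Otherwise \<open>p\<close> would be a quadratic with three roots, hence zero,
      against \<open>u \<noteq> 0\<close>.\<close>
    show "\<not> (u $ 4 = 0 \<and> v = 0)"
    proof
      assume "u $ 4 = 0 \<and> v = 0"
      hence "u $ 3 = 0 \<and> u $ 2 = 0 \<and> u $ 1 = 0"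
        using quadratic_three_roots[of "- (u $ 3)" "t a" "- (u $ 2)" "- (u $ 1)" "t b" "t d"] z
        by (auto simp: p_def)
      with \<open>u $ 4 = 0 \<and> v = 0\<close> nz show False by (simp add: vec_eq_iff forall_4)
    qed
  qed
  have fin: "finite Z" unfolding Z_def by simp
  show ?thesis
  proof (cases "0 \<in> Z")
    case False
    obtain W where W: "W \<subseteq> Z" "card W = 4"
      using card obtain_subset_with_card_n[of 4 Z] unfolding Z_def by metis
    obtain a b c d where abcd: "a < b" "b < c" "c < d" "W = {a, b, c, d}"
      using W(2) by (rule card_4_nat_sorted)
    have Z: "a \<in> Z" "b \<in> Z" "c \<in> Z" "d \<in> Z" using W(1) abcd(4) by auto
    have le: "1 \<le> a" "d \<le> m" using Z False unfolding Z_def by (auto intro: Suc_leI gr0I)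
    define e where "e = - (u $ 4)"
    have f: "p s = (s - t a) * (s - t b) * (s - t c) * (e * (s + t a + t b + t c) + v)" for s
      unfolding e_def using factor[of a b c s] Z abcd le by auto
    have "p (t d) = 0" using Z le abcd p_zero[of d] by auto
    moreover have td: "t a < t b" "t b < t c" "t c < t d" using abcd le by (auto intro: t_mono)
    ultimately have "e * (t d + t a + t b + t c) + v = 0" unfolding f by auto
    hence ve: "v = - e * (t a + t b + t c + t d)" by (simp add: algebra_simps)
    have f: "p s = e * ((s - t a) * (s - t b) * (s - t c) * (s - t d))" for s
      unfolding f ve by (simp add: algebra_simps)
    have "v > 0" using v False by auto
    have "Z \<subseteq> W"
    proof
      fix k assume k: "k \<in> Z"
      hence k1: "1 \<le> k" "k \<le> m" using False unfolding Z_def by (auto intro: Suc_leI gr0I)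
      have "e \<noteq> 0" using \<open>v > 0\<close> ve by auto
      hence "t k = t a \<or> t k = t b \<or> t k = t c \<or> t k = t d"
        using k p_zero[OF k1] f[of "t k"] by auto
      thus "k \<in> W" unfolding abcd(4) using t_eq_iff k1 le abcd(1-3) by auto
    qed
    \<comment> \<open>With \<open>e < 0\<close> the quartic is negative left of all its roots, so
      \<open>a = 1\<close>. Then \<open>G 1 d\<close> makes the root sum negative, and
      \<open>ve\<close> contradicts \<open>v > 0\<close>.\<close>
    have "\<not> e < 0"
    proof
      assume e: "e < 0"
      have "a = 1"
      proof (rule ccontr)
        assume "a \<noteq> 1"
        hence "t 1 < t a" using le abcd by (auto intro: t_mono)
        with td have "0 < (t 1 - t a) * (t 1 - t b) * (t 1 - t c) * (t 1 - t d)"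
          by (auto simp: zero_less_mult_iff mult_less_0_iff)
        hence "p (t 1) < 0" unfolding f using e by (rule mult_neg_pos[rotated])
        thus False using p_nonneg[of 1] m by simp
      qed
      moreover from this G_1[of d] le have "t a + t b + t c + t d < 0"
        using abcd by (intro t_neg) auto
      ultimately show False using ve e \<open>v > 0\<close> by (simp add: mult_less_0_iff zero_less_mult_iff)
    qed
    hence e: "e > 0" using \<open>v > 0\<close> ve by (cases "e = 0") auto
    hence "t a + t b + t c + t d < 0" using ve \<open>v > 0\<close> by (simp add: mult_less_0_iff zero_less_mult_iff)
    hence G: "G a d" using t_pos[of a b c d] le abcd by fastforce
    \<comment> \<open>The quartic is negative between its first two and between its last two roots,
      so no index fits into either gap.\<close>
    have b: "b = Suc a"
    proof (rule ccontr)
      assume "b \<noteq> Suc a"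
      hence "t a < t (Suc a)" "t (Suc a) < t b" using le abcd by (auto intro: t_mono)
      with td have "(t (Suc a) - t a) * (t (Suc a) - t b) * (t (Suc a) - t c) * (t (Suc a) - t d) < 0"
        by (auto simp: zero_less_mult_iff mult_less_0_iff)
      hence "p (t (Suc a)) < 0" unfolding f by (rule mult_pos_neg[OF e])
      thus False using p_nonneg[of "Suc a"] le abcd by simp
    qed
    have d: "d = Suc c"
    proof (rule ccontr)
      assume "d \<noteq> Suc c"
      hence "t c < t (Suc c)" "t (Suc c) < t d" using le abcd by (auto intro: t_mono)
      with td have "(t (Suc c) - t a) * (t (Suc c) - t b) * (t (Suc c) - t c) * (t (Suc c) - t d) < 0"
        by (auto simp: zero_less_mult_iff mult_less_0_iff)
      hence "p (t (Suc c)) < 0" unfolding f by (rule mult_pos_neg[OF e])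
      thus False using p_nonneg[of "Suc c"] le abcd by simp
    qed
    have "good a c" using G b d le abcd by (auto simp: good_def)
    hence "W \<in> sphere_facets" unfolding abcd(4) b d by (rule sphere_facet_if_good)
    with \<open>Z \<subseteq> W\<close> show ?thesis unfolding Z_def by blast
  next
    case True
    hence "card (Z - {0}) = card Z - 1" using fin by simp
    hence "3 \<le> card (Z - {0})" using card unfolding Z_def by linarith
    then obtain W where W: "W \<subseteq> Z - {0}" "card W = 3"
      using obtain_subset_with_card_n[of 3 "Z - {0}"] by metis
    obtain a b d where abd: "a < b" "b < d" "W = {a, b, d}"
      using W(2) by (rule card_3_nat_sorted)
    have Z: "a \<in> Z" "b \<in> Z" "d \<in> Z" "a \<noteq> 0" using W(1) abd(3) by auto
    have le: "1 \<le> a" "d \<le> m" using Z unfolding Z_def by auto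
    define e where "e = - (u $ 4)"
    have v0: "v = 0" using v True by simp
    have f: "p s = e * ridge_quartic a b d s" for s
      using factor[of a b d s] Z abd le v0 unfolding e_def ridge_quartic_def by simp
    have e: "e \<noteq> 0" using not_both[of a b d] Z abd le v0 unfolding e_def by simp
    \<comment> \<open>The fourth root coincides with no other vertex parameter, because four-term
      sums are never 0.\<close>
    have nz: "ridge_quartic a b d (t k) \<noteq> 0" if k: "1 \<le> k" "k \<le> m" "k \<notin> {a, b, d}" for k
    proof -
      have "t k + t a + t b + t d \<noteq> 0" using sum_sign[OF k(1,2) le(1) abd(1,2) le(2)] by linarith
      thus ?thesis using t_eq_iff k le abd unfolding ridge_quartic_def by auto
    qed
    have "Z \<subseteq> {0, a, b, d}"
    proof
      fix k assume k: "k \<in> Z"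
      show "k \<in> {0, a, b, d}"
      proof (rule ccontr)
        assume n: "k \<notin> {0, a, b, d}"
        hence k1: "1 \<le> k" "k \<le> m" using k unfolding Z_def by auto
        show False using nz[OF k1] n p_zero[OF k1] k e f by auto
      qed
    qed
    moreover have "ridge a b d"
    proof (cases "e > 0")
      case True
      have "ridge_pos a b d k" if k: "1 \<le> k" "k \<le> m" for k
      proof (cases "k \<in> {a, b, d}")
        case True
        thus ?thesis using abd by (auto simp: ridge_pos_def)
      next
        case False
        have "0 \<le> ridge_quartic a b d (t k)"
          using p_nonneg[OF k] \<open>e > 0\<close> unfolding f by (simp add: zero_le_mult_iff)
        with nz[OF k False] have "0 < ridge_quartic a b d (t k)" by simp
        thus ?thesis using ridge_quartic_sign(1)[of k a b d] k False le abd by auto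
      qed
      thus ?thesis using le abd by (intro ridge_if_pos)
    next
      case False
      hence neg: "e < 0" using e by simp
      have "ridge_neg a b d k" if k: "1 \<le> k" "k \<le> m" for k
      proof (cases "k \<in> {a, b, d}")
        case True
        thus ?thesis using abd by (auto simp: ridge_neg_def)
      next
        case False
        have "ridge_quartic a b d (t k) \<le> 0"
          using p_nonneg[OF k] neg unfolding f by (simp add: zero_le_mult_iff)
        with nz[OF k False] have "ridge_quartic a b d (t k) < 0" by simp
        thus ?thesis using ridge_quartic_sign(2)[of k a b d] k False le abd by auto
      qed
      thus ?thesis using le abd by (intro ridge_if_neg)
    qed
    ultimately show ?thesis
      using sphere_facet_if_ridge[of a b d] le abd unfolding Z_def by blast
  qed
qed

lemma sphere_realized:
  "\<exists>P :: (real ^ 4) set. simplicial_polytope P \<and> aff_dim P = 4 \<and>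
     combinatorially_isomorphic (complex_of_facets sphere_facets) (polytope_boundary P)"
proof -
  have D: "DIM(real ^ 4) = 4" by simp
  have "good 1 3" using m G_1[of 4] by (auto simp: good_def)
  hence ne: "sphere_facets \<noteq> {}" using sphere_facet_if_good by blast
  have facet: "r \<subseteq> {0..m} \<and> card r = DIM(real ^ 4)" if "r \<in> sphere_facets" for r
    using sphere_facet_subset[OF that] that by (simp add: sphere_facets_def)
  have V: "DIM(real ^ 4) < card {0..m}" using m by simp
  have compl: "\<exists>\<sigma>\<in>sphere_facets. {k\<in>{0..m}. a \<bullet> point k = b} \<subseteq> \<sigma>"
    if "a \<noteq> 0" "\<forall>k\<in>{0..m}. a \<bullet> point k \<le> b"
      "DIM(real ^ 4) \<le> card {k\<in>{0..m}. a \<bullet> point k = b}" for a b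
    using sphere_facets_complete[OF that(1,2)] that(3) unfolding D .
  note realize = convex_hull_simplicial_from_facets[OF finite_atLeastAtMost V ne, where x = point]
  note hyps = facet sphere_facet_supporting sphere_facet_independent compl
  have 1: "simplicial_polytope (convex hull (point ` {0..m}))"
    by (rule realize(1)) (fact hyps)+
  have 2: "aff_dim (convex hull (point ` {0..m})) = int DIM(real ^ 4)"
    by (rule realize(2)) (fact hyps)+
  have 3: "combinatorially_isomorphic (complex_of_facets sphere_facets)
      (polytope_boundary (convex hull (point ` {0..m})))"
    by (rule realize(3)) (fact hyps)+
  have "aff_dim (convex hull (point ` {0..m})) = 4"
    using 2 unfolding D of_nat_numeral .
  with 1 3 show ?thesis by iprover
qed

end

section \<open>Squeezed spheres\<close>

lemma set_preceq_pairsI: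
  fixes i j i' j' :: nat
  assumes "1 \<le> i'" "Suc i' < j'" "i' \<le> i" "j' \<le> j" "Suc i < j"
  shows "{0, i', Suc i', j', Suc j'} \<preceq> {0, i, Suc i, j, Suc j}"
proof -
  have sorted: "sorted_list_of_set {0, p, Suc p, q, Suc q} = [0, p, Suc p, q, Suc q]"
    if "1 \<le> p" "Suc p < q" for p q :: nat
    using that sorted_list_of_set.idem_if_sorted_distinct[of "[0, p, Suc p, q, Suc q]"] by simp
  show ?thesis
    unfolding set_preceq_def using assms by (simp add: sorted)
qed

text \<open>A 5-element face lies in a 5-element generator and hence equals it, so the
  top-dimensional faces of the ball are the members of \<open>I\<close>.\<close>

lemma squeezed_sphere_alt:
  assumes "\<And>f. f \<in> I \<Longrightarrow> finite f \<and> card f = 5"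
  shows "squeezed_sphere I = complex_of_facets {r. card r = 4 \<and> (\<exists>!f. f \<in> I \<and> r \<subseteq> f)}"
proof -
  have top: "f \<in> complex_of_facets I \<and> card f = 4 + 1 \<longleftrightarrow> f \<in> I" for f
  proof
    assume "f \<in> complex_of_facets I \<and> card f = 4 + 1"
    then obtain g where g: "g \<in> I" "f \<subseteq> g" "card f = 5" by (auto simp: complex_of_facets_def)
    hence "f = g" using assms[OF g(1)] by (intro card_subset_eq) auto
    with g(1) show "f \<in> I" by simp
  qed (use assms in \<open>auto simp: complex_of_facets_def\<close>)
  have "(r \<in> complex_of_facets I \<and> card r = 4 \<and>
        (\<exists>!f. f \<in> complex_of_facets I \<and> card f = 4 + 1 \<and> r \<subseteq> f)) \<longleftrightarrow>
      card r = 4 \<and> (\<exists>!f. f \<in> I \<and> r \<subseteq> f)" for r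
    unfolding conj_assoc[symmetric] top by (auto simp: complex_of_facets_def)
  thus ?thesis
    unfolding squeezed_sphere_def squeezed_ball_def boundary_complex_def by simp
qed

theorem theorem2:
  fixes n :: nat and I :: "nat set set"
  assumes "n \<ge> 4"
    and "order_ideal_F4 n I"
    and "I \<noteq> {}"
    and "n \<ge> Max (\<Union> I)"
  shows "\<exists>P :: (real ^ 4) set. simplicial_polytope P \<and> aff_dim P = 4 \<and>
           combinatorially_isomorphic (squeezed_sphere I) (polytope_boundary P)"
proof -
  define J where "J i j \<longleftrightarrow> 1 \<le> i \<and> Suc i < j \<and> {0, i, Suc i, j, Suc j} \<in> I" for i j
  have J_ex: "\<exists>i j. J i j \<and> f = {0, i, Suc i, j, Suc j} \<and> Suc j \<le> n" if "f \<in> I" for f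
  proof -
    have "f \<in> F4 n" using that assms(2) by (auto simp: order_ideal_F4_def)
    then obtain i j where ij: "f = {0, i, Suc i, j, Suc j}" "1 \<le> i" "i + 2 \<le> j" "j + 1 \<le> n"
      unfolding F4_def F3_def by auto
    moreover have "J i j" using ij that by (simp add: J_def)
    ultimately show ?thesis by (intro exI[of _ i] exI[of _ j]) simp
  qed
  have J_n: "Suc j \<le> n" if "J i j" for i j
  proof -
    from that have "{0, i, Suc i, j, Suc j} \<in> I" by (simp add: J_def)
    from J_ex[OF this] obtain i' j' where
      "J i' j'" "{0, i, Suc i, j, Suc j} = {0, i', Suc i', j', Suc j'}" "Suc j' \<le> n" by blast
    hence "Suc j \<in> {0, i', Suc i', j', Suc j'}" by blast
    with \<open>Suc j' \<le> n\<close> \<open>J i' j'\<close> show ?thesis by (auto simp: J_def)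
  qed
  have J_down: "J i' j'" if "J i j" "1 \<le> i'" "Suc i' < j'" "i' \<le> i" "j' \<le> j" for i j i' j'
  proof -
    have "{i', i' + 1, j', j' + 1} \<in> F3 n"
      using J_n[OF that(1)] that(2-) unfolding F3_def by force
    hence "{0} \<union> {i', i' + 1, j', j' + 1} \<in> F4 n" unfolding F4_def by blast
    hence "{0, i', Suc i', j', Suc j'} \<in> F4 n"
      by (simp only: insert_is_Un[symmetric] Suc_eq_plus1)
    moreover have "{0, i', Suc i', j', Suc j'} \<preceq> {0, i, Suc i, j, Suc j}"
      using that by (intro set_preceq_pairsI) (auto simp: J_def)
    ultimately show ?thesis
      using assms(2) that by (auto simp: order_ideal_F4_def J_def)
  qed

  \<comment> \<open>Labels above the largest one in use occur in no face. Replacing \<open>n\<close>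
    by \<open>m\<close> ensures that some facet ends at \<open>m\<close>, which yields
    \<open>G 1 m\<close>.\<close>
  define m where "m = Max (\<Union> I)"
  have "\<Union> I \<subseteq> {..n}"
  proof
    fix k assume "k \<in> \<Union> I"
    then obtain f where "f \<in> I" "k \<in> f" by blast
    with J_ex[OF this(1)] show "k \<in> {..n}" by (auto simp: J_def)
  qed
  hence fin: "finite (\<Union> I)" by (rule finite_subset) simp
  have J_m: "Suc j \<le> m" if "J i j" for i j
  proof -
    from that have "{0, i, Suc i, j, Suc j} \<in> I" by (simp add: J_def)
    hence "Suc j \<in> \<Union> I" by (rule UnionI) simp
    thus ?thesis unfolding m_def by (rule Max_ge[OF fin])
  qed
  have "\<exists>i j. J i j \<and> Suc j = m"
  proof -
    obtain f where "f \<in> I" using assms(3) by blast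
    moreover from J_ex[OF this] have "0 \<in> f" by blast
    ultimately have "\<Union> I \<noteq> {}" by blast
    hence "m \<in> \<Union> I" unfolding m_def using Max_in[OF fin] by blast
    then obtain f where f: "f \<in> I" "m \<in> f" by blast
    from J_ex[OF f(1)] obtain i j where ij: "J i j" "f = {0, i, Suc i, j, Suc j}" by blast
    have "m \<le> Suc j" using f(2) ij by (auto simp: J_def)
    with J_m[OF ij(1)] ij(1) show ?thesis by (intro exI[of _ i] exI[of _ j]) simp
  qed
  then obtain i0 j0 where top: "J i0 j0" "Suc j0 = m" by blast

  \<comment> \<open>The edge \<open>i, i + 1\<close> is indexed by its left and \<open>j, j + 1\<close> by its right endpoint, since the
    extreme summands decide the sign of a sum of four points.\<close>
  define G where "G a b \<longleftrightarrow> (\<exists>i j. J i j \<and> (a \<le> i \<and> b \<le> Suc j \<or> b \<le> i \<and> a \<le> Suc j))" for a b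
  have G_sym: "G b a" if "G a b" for a b using that unfolding G_def by blast
  have G_down: "G a' b'" if "G a b" "a' \<le> a" "b' \<le> b" for a b a' b'
    using that unfolding G_def by (meson le_trans)
  define t where "t = threshold_point m G"
  have t_less: "t a < t b" if "1 \<le> a" "a < b" "b \<le> m" for a b
    unfolding t_def by (rule threshold_point(1)) (fact G_sym G_down that)+
  have t_neg: "t a + t b + t c + t d < 0"
    if "1 \<le> a" "a \<le> b" "b \<le> c" "c \<le> d" "d \<le> m" "G a d" for a b c d
    unfolding t_def by (rule threshold_point(2)) (fact G_sym G_down that)+
  have t_pos: "t a + t b + t c + t d > 0"
    if "1 \<le> a" "a \<le> b" "b \<le> c" "c \<le> d" "d \<le> m" "\<not> G a d" for a b c d
    unfolding t_def by (rule threshold_point(3)) (fact G_sym G_down that)+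
  define M where "M = 1 + (\<Sum>k\<in>{1..m}. \<bar>t k ^ 3\<bar>)"
  have M: "0 < M + t k ^ 3" if "1 \<le> k" "k \<le> m" for k
  proof -
    have "\<bar>t k ^ 3\<bar> \<le> (\<Sum>k\<in>{1..m}. \<bar>t k ^ 3\<bar>)"
      using that by (intro member_le_sum) auto
    thus ?thesis unfolding M_def by linarith
  qed
  interpret squeezed_curve m G t M
  proof
    show "4 \<le> m" using top by (auto simp: J_def)
    show "G 1 m" unfolding G_def using top by (intro exI[of _ i0] exI[of _ j0]) (auto simp: J_def)
  qed (fact G_down t_less t_neg t_pos M)+
  have good_iff: "good i j \<longleftrightarrow> J i j" for i j
  proof
    assume "good i j"
    then obtain i' j' where *: "1 \<le> i" "Suc i < j" "J i' j'"
        "i \<le> i' \<and> Suc j \<le> Suc j' \<or> Suc j \<le> i' \<and> i \<le> Suc j'"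
      unfolding good_def G_def by blast
    \<comment> \<open>In the swapped alternative \<open>Suc j \<le> i'\<close> this also follows,
      since \<open>Suc i < j\<close> and \<open>Suc i' < j'\<close>; so symmetrizing
      \<open>G\<close> adds no quadruple.\<close>
    hence "i \<le> i' \<and> j \<le> j'" by (auto simp: J_def)
    with J_down[OF *(3,1,2)] show "J i j" by blast
  next
    assume J: "J i j"
    have "G i (Suc j)" unfolding G_def using J by blast
    with J J_m[OF J] show "good i j" by (auto simp: good_def J_def)
  qed
  have "ball_facets = I"
  proof
    show "ball_facets \<subseteq> I" unfolding ball_facets_def good_iff by (auto simp: J_def)
    show "I \<subseteq> ball_facets" unfolding ball_facets_def good_iff using J_ex by blast
  qed
  moreover have "finite f \<and> card f = 5" if "f \<in> I" for f
    using J_ex[OF that] by (auto simp: J_def)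
  ultimately have "squeezed_sphere I = complex_of_facets sphere_facets"
    unfolding sphere_facets_def by (simp add: squeezed_sphere_alt)
  with sphere_realized show ?thesis by simp
qed

end
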